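(* Let $\mathfrak p\subset\mathfrak{gl}(V,V_* )$ be a subalgebra such that $\mathfrak p=(\mathfrak n_{\mathfrak p})^\perp$, the orthogonal complement in $\mathfrak{gl}(V,V_* )$ of the linear nilradical of $\mathfrak p$ with respect to the form $(X,Y)\mapsto\mathrm{tr}(XY)$. Then $\mathfrak p$ is a parabolic subalgebra of $\mathfrak{gl}(V,V_* )$.
   Context: $V,V_*$: countable-dimensional complex spaces with nondegenerate pairing; $\mathfrak{gl}(V,V_* )$ is the Lie algebra of $V\otimes V_*$ with product $(v\otimes w)(v'\otimes w')=\langle v',w\rangle v\otimes w'$; its elements are finite-rank endomorphisms of $V$, and $\mathrm{tr}$ is the trace ($\mathrm{tr}(v\otimes w)=\langle v,w\rangle$). Linear nilradical $\mathfrak n_{\mathfrak p}$: elements of the largest locally solvable ideal of $\mathfrak p$ that are nilpotent endomorphisms of $V$. Borel subalgebra: maximal locally solvable subalgebra; parabolic subalgebra: subalgebra containing a Borel subalgebra. *)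

theory Defs
  imports Complex_Main "HOL-Library.Countable_Set"
begin

text \<open>Setting: V is a complex vector space on type 'v with scalar multiplication sV,
  V_* a complex vector space on type 'w with scalar multiplication sW, and
  pr :: 'v => 'w => complex the pairing. Elements of gl(V,V_*) are represented
  by the endomorphisms of V they induce.\<close>

definition countable_dim :: "(complex \<Rightarrow> 'a \<Rightarrow> 'a::ab_group_add) \<Rightarrow> bool" where
  "countable_dim s \<longleftrightarrow> (\<exists>B. countable B \<and> module.span s B = UNIV)"

definition bilinear_pairing ::
  "(complex \<Rightarrow> 'v \<Rightarrow> 'v::ab_group_add) \<Rightarrow> (complex \<Rightarrow> 'w \<Rightarrow> 'w::ab_group_add)
   \<Rightarrow> ('v \<Rightarrow> 'w \<Rightarrow> complex) \<Rightarrow> bool" where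
  "bilinear_pairing sV sW pr \<longleftrightarrow>
     (\<forall>a v v' w. pr (sV a v + v') w = a * pr v w + pr v' w) \<and>
     (\<forall>a v w w'. pr v (sW a w + w') = a * pr v w + pr v w')"

definition nondegenerate_pairing :: "('v::zero \<Rightarrow> 'w::zero \<Rightarrow> complex) \<Rightarrow> bool" where
  "nondegenerate_pairing pr \<longleftrightarrow>
     (\<forall>v. (\<forall>w. pr v w = 0) \<longrightarrow> v = 0) \<and> (\<forall>w. (\<forall>v. pr v w = 0) \<longrightarrow> w = 0)"

text \<open>The endomorphism of V induced by a finite sum of elementary tensors v \<otimes> w,
  where (v \<otimes> w)(u) = <u,w> v.\<close>
definition tensor_op ::
  "(complex \<Rightarrow> 'v \<Rightarrow> 'v::ab_group_add) \<Rightarrow> ('v \<Rightarrow> 'w \<Rightarrow> complex) \<Rightarrow> ('v \<times> 'w) list \<Rightarrow> 'v \<Rightarrow> 'v" where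
  "tensor_op sV pr ps = (\<lambda>u. sum_list (map (\<lambda>(v, w). sV (pr u w) v) ps))"

definition gl :: "(complex \<Rightarrow> 'v \<Rightarrow> 'v::ab_group_add) \<Rightarrow> ('v \<Rightarrow> 'w \<Rightarrow> complex) \<Rightarrow> ('v \<Rightarrow> 'v) set" where
  "gl sV pr = {X. \<exists>ps. X = tensor_op sV pr ps}"

definition tr :: "(complex \<Rightarrow> 'v \<Rightarrow> 'v::ab_group_add) \<Rightarrow> ('v \<Rightarrow> 'w \<Rightarrow> complex) \<Rightarrow> ('v \<Rightarrow> 'v) \<Rightarrow> complex" where
  "tr sV pr X = (THE c. \<exists>ps. X = tensor_op sV pr ps \<and> c = sum_list (map (\<lambda>(v, w). pr v w) ps))"

definition lie_bracket :: "('v \<Rightarrow> 'v::ab_group_add) \<Rightarrow> ('v \<Rightarrow> 'v) \<Rightarrow> ('v \<Rightarrow> 'v)" where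
  "lie_bracket X Y = (\<lambda>u. X (Y u) - Y (X u))"

definition endo_subspace :: "(complex \<Rightarrow> 'v \<Rightarrow> 'v::ab_group_add) \<Rightarrow> ('v \<Rightarrow> 'v) set \<Rightarrow> bool" where
  "endo_subspace sV S \<longleftrightarrow> (\<lambda>_. 0) \<in> S \<and>
     (\<forall>X\<in>S. \<forall>Y\<in>S. (\<lambda>u. X u + Y u) \<in> S) \<and> (\<forall>c. \<forall>X\<in>S. (\<lambda>u. sV c (X u)) \<in> S)"

definition endo_span :: "(complex \<Rightarrow> 'v \<Rightarrow> 'v::ab_group_add) \<Rightarrow> ('v \<Rightarrow> 'v) set \<Rightarrow> ('v \<Rightarrow> 'v) set" where
  "endo_span sV A = \<Inter>{S. endo_subspace sV S \<and> A \<subseteq> S}"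

definition subalgebra :: "(complex \<Rightarrow> 'v \<Rightarrow> 'v::ab_group_add) \<Rightarrow> ('v \<Rightarrow> 'w \<Rightarrow> complex) \<Rightarrow> ('v \<Rightarrow> 'v) set \<Rightarrow> bool" where
  "subalgebra sV pr S \<longleftrightarrow> endo_subspace sV S \<and> S \<subseteq> gl sV pr \<and>
     (\<forall>X\<in>S. \<forall>Y\<in>S. lie_bracket X Y \<in> S)"

definition generated_subalgebra ::
  "(complex \<Rightarrow> 'v \<Rightarrow> 'v::ab_group_add) \<Rightarrow> ('v \<Rightarrow> 'w \<Rightarrow> complex) \<Rightarrow> ('v \<Rightarrow> 'v) set \<Rightarrow> ('v \<Rightarrow> 'v) set" where
  "generated_subalgebra sV pr F = \<Inter>{S. subalgebra sV pr S \<and> F \<subseteq> S}"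

fun derived_series :: "(complex \<Rightarrow> 'v \<Rightarrow> 'v::ab_group_add) \<Rightarrow> ('v \<Rightarrow> 'v) set \<Rightarrow> nat \<Rightarrow> ('v \<Rightarrow> 'v) set" where
  "derived_series sV S 0 = S"
| "derived_series sV S (Suc n) =
     endo_span sV {lie_bracket X Y | X Y. X \<in> derived_series sV S n \<and> Y \<in> derived_series sV S n}"

definition solvable :: "(complex \<Rightarrow> 'v \<Rightarrow> 'v::ab_group_add) \<Rightarrow> ('v \<Rightarrow> 'v) set \<Rightarrow> bool" where
  "solvable sV S \<longleftrightarrow> (\<exists>n. derived_series sV S n = {\<lambda>_. 0})"

definition locally_solvable ::
  "(complex \<Rightarrow> 'v \<Rightarrow> 'v::ab_group_add) \<Rightarrow> ('v \<Rightarrow> 'w \<Rightarrow> complex) \<Rightarrow> ('v \<Rightarrow> 'v) set \<Rightarrow> bool" where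
  "locally_solvable sV pr S \<longleftrightarrow>
     (\<forall>F. finite F \<and> F \<subseteq> S \<longrightarrow> solvable sV (generated_subalgebra sV pr F))"

definition lie_ideal ::
  "(complex \<Rightarrow> 'v \<Rightarrow> 'v::ab_group_add) \<Rightarrow> ('v \<Rightarrow> 'v) set \<Rightarrow> ('v \<Rightarrow> 'v) set \<Rightarrow> bool" where
  "lie_ideal sV I P \<longleftrightarrow> endo_subspace sV I \<and> I \<subseteq> P \<and> (\<forall>X\<in>P. \<forall>Y\<in>I. lie_bracket X Y \<in> I)"

definition ls_radical ::
  "(complex \<Rightarrow> 'v \<Rightarrow> 'v::ab_group_add) \<Rightarrow> ('v \<Rightarrow> 'w \<Rightarrow> complex) \<Rightarrow> ('v \<Rightarrow> 'v) set \<Rightarrow> ('v \<Rightarrow> 'v) set" where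
  "ls_radical sV pr P = (GREATEST I. lie_ideal sV I P \<and> locally_solvable sV pr I)"

definition nilpotent_endo :: "('v \<Rightarrow> 'v::zero) \<Rightarrow> bool" where
  "nilpotent_endo X \<longleftrightarrow> (\<exists>n. (X ^^ n) = (\<lambda>_. 0))"

definition linear_nilradical ::
  "(complex \<Rightarrow> 'v \<Rightarrow> 'v::ab_group_add) \<Rightarrow> ('v \<Rightarrow> 'w \<Rightarrow> complex) \<Rightarrow> ('v \<Rightarrow> 'v) set \<Rightarrow> ('v \<Rightarrow> 'v) set" where
  "linear_nilradical sV pr P = {X \<in> ls_radical sV pr P. nilpotent_endo X}"

definition orth_compl ::
  "(complex \<Rightarrow> 'v \<Rightarrow> 'v::ab_group_add) \<Rightarrow> ('v \<Rightarrow> 'w \<Rightarrow> complex) \<Rightarrow> ('v \<Rightarrow> 'v) set \<Rightarrow> ('v \<Rightarrow> 'v) set" where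
  "orth_compl sV pr A = {X \<in> gl sV pr. \<forall>Y\<in>A. tr sV pr (X \<circ> Y) = 0}"

definition borel_subalgebra ::
  "(complex \<Rightarrow> 'v \<Rightarrow> 'v::ab_group_add) \<Rightarrow> ('v \<Rightarrow> 'w \<Rightarrow> complex) \<Rightarrow> ('v \<Rightarrow> 'v) set \<Rightarrow> bool" where
  "borel_subalgebra sV pr B \<longleftrightarrow> subalgebra sV pr B \<and> locally_solvable sV pr B \<and>
     (\<forall>B'. subalgebra sV pr B' \<and> locally_solvable sV pr B' \<and> B \<subseteq> B' \<longrightarrow> B' = B)"

definition parabolic_subalgebra ::
  "(complex \<Rightarrow> 'v \<Rightarrow> 'v::ab_group_add) \<Rightarrow> ('v \<Rightarrow> 'w \<Rightarrow> complex) \<Rightarrow> ('v \<Rightarrow> 'v) set \<Rightarrow> bool" where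
  "parabolic_subalgebra sV pr P \<longleftrightarrow> subalgebra sV pr P \<and> (\<exists>B. borel_subalgebra sV pr B \<and> B \<subseteq> P)"

end

theory Submission
  imports Defs "HOL-Computational_Algebra.Fundamental_Theorem_Algebra"
    "HOL-Library.Function_Algebras"
begin

text \<open>Let \<open>N\<close> be the linear nilradical of \<open>P\<close>, let \<open>B\<close> be maximal among the locally solvable
  subalgebras of \<open>P\<close> containing its locally solvable radical, and let \<open>B'\<close> be a locally solvable
  subalgebra of \<open>gl(V,V_*)\<close> containing \<open>B\<close>. By Lie's theorem, any \<open>X, Y \<in> B'\<close> are simultaneously
  triangular on a finite-dimensional space containing their images, so \<open>tr (XY) = 0\<close> whenever \<open>Y\<close>
  is nilpotent. For \<open>Y \<in> N \<subseteq> B\<close> this gives \<open>B' \<subseteq> N\<^sup>\<bottom> = P\<close>, hence \<open>B' = B\<close>, so \<open>B\<close> is a Borel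
  subalgebra contained in \<open>P\<close>. To avoid quotient spaces, Lie's theorem is proved modulo an invariant
  subspace \<open>K\<close>.\<close>

subsection \<open>Dimension and Krylov subspaces modulo an invariant subspace\<close>

text \<open>The bridge is finite rank: all operators in the subalgebra generated by \<open>X\<close>
  and \<open>Y\<close> have range in one finite-dimensional space, which they preserve and on which
  the trace of \<open>XY\<close> can be computed. The subspace \<open>K\<close> is the part of a
  flag that is already built: the next flag vector is a common eigenvector modulo the span of the
  earlier ones, so every statement is made relative to \<open>K\<close> from the start. Two
  definitions presuppose facts. \<open>tr\<close> is a definite description, so independence of the
  chosen tensor has to be shown. \<open>ls_radical\<close> is a greatest element, which exists
  because sums of two locally solvable ideals are again locally solvable; in infinite dimension this
  rests on finitely generated subalgebras being finite-dimensional. Maximality of \<open>B\<close>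
  is first sought only inside \<open>P\<close>, which secures \<open>B \<subseteq> P\<close>; the
  trace argument then confines every larger locally solvable subalgebra to \<open>P\<close>, and so
  turns relative maximality into absolute maximality.\<close>

locale complex_vector_space = vector_space scale
  for scale :: "complex \<Rightarrow> 'v \<Rightarrow> 'v::ab_group_add" (infixr \<open>*s\<close> 75)
begin

abbreviation endomorphism :: "('v \<Rightarrow> 'v) \<Rightarrow> bool"
  where "endomorphism \<equiv> Vector_Spaces.linear scale scale"

abbreviation invariant :: "('v \<Rightarrow> 'v) \<Rightarrow> 'v set \<Rightarrow> bool"
  where "invariant X S \<equiv> X ` S \<subseteq> S"

lemma endomorphism_iff:
  "endomorphism X \<longleftrightarrow> (\<forall>x y. X (x + y) = X x + X y) \<and> (\<forall>c x. X (c *s x) = c *s X x)"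
  using vector_space_axioms by (auto simp: Vector_Spaces.linear_iff)

lemma
  assumes "endomorphism X"
  shows endomorphism_add: "X (x + y) = X x + X y"
    and endomorphism_scale: "X (c *s x) = c *s X x"
    and endomorphism_0: "X 0 = 0"
    and endomorphism_diff: "X (x - y) = X x - X y"
    and endomorphism_sum: "X (sum f A) = (\<Sum>i\<in>A. X (f i))"
proof -
  interpret Vector_Spaces.linear scale scale X by fact
  show "X (x + y) = X x + X y" "X (c *s x) = c *s X x" "X 0 = 0" "X (x - y) = X x - X y"
    "X (sum f A) = (\<Sum>i\<in>A. X (f i))"
    by (fact add scale zero diff sum)+
qed

lemma subspace_scale_cancel: "subspace S \<Longrightarrow> c *s x \<in> S \<Longrightarrow> c \<noteq> 0 \<Longrightarrow> x \<in> S"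
  using subspace_scale[of S "c *s x" "inverse c"] by simp

text \<open>\<open>dim\<close> is 0 on a space without a finite basis, so strictness depends on the
  finite set \<open>F\<close>. A basis of \<open>A\<close> extended to one of \<open>B\<close> must
  then gain a vector.\<close>

lemma dim_strict_mono:
  assumes "subspace A" "A \<subset> B" "B \<subseteq> span F" "finite F"
  shows "dim A < dim B"
proof -
  obtain C where C: "C \<subseteq> A" "independent C" "A \<subseteq> span C"
    using basis_exists[of A] by metis
  obtain D where D: "C \<subseteq> D" "D \<subseteq> B" "independent D" "B \<subseteq> span D"
    using maximal_independent_subset_extend[of C B] C assms(2) by (metis psubset_imp_subset subset_trans)
  have "finite D"
    using independent_span_bound[OF \<open>finite F\<close>] D assms(3) by (metis subset_trans)
  moreover have "C \<noteq> D"
    using C D assms(1,2) span_minimal[OF C(1) assms(1)] by blast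
  ultimately have "card C < card D"
    using D(1) by (intro psubset_card_mono) auto
  then show ?thesis
    using basis_card_eq_dim C D by metis
qed

text \<open>For an \<open>X\<close>-invariant subspace \<open>K\<close>, this is the preimage in V
  of the span of the first \<open>n\<close> iterates of the class of \<open>v\<close> in
  V/K.\<close>

definition krylov :: "'v set \<Rightarrow> ('v \<Rightarrow> 'v) \<Rightarrow> 'v \<Rightarrow> nat \<Rightarrow> 'v set"
  where "krylov K X v n = span (K \<union> (\<lambda>i. (X ^^ i) v) ` {..<n})"

lemma subspace_krylov: "subspace (krylov K X v n)"
  by (simp add: krylov_def)

lemma krylov_base: "x \<in> K \<Longrightarrow> x \<in> krylov K X v n"
  by (simp add: krylov_def span_base)

lemma krylov_power: "i < n \<Longrightarrow> (X ^^ i) v \<in> krylov K X v n"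
  by (simp add: krylov_def span_base)

lemma krylov_mono: "m \<le> n \<Longrightarrow> krylov K X v m \<subseteq> krylov K X v n"
  unfolding krylov_def by (intro span_mono) auto

lemma krylov_0: "subspace K \<Longrightarrow> krylov K X v 0 = K"
  by (simp add: krylov_def)

lemma endomorphism_krylov:
  assumes "endomorphism Y" "subspace S" "Y ` K \<subseteq> S" "\<And>i. i < n \<Longrightarrow> Y ((X ^^ i) v) \<in> S"
    and "x \<in> krylov K X v n"
  shows "Y x \<in> S"
proof -
  have "krylov K X v n \<subseteq> {x. Y x \<in> S}"
    unfolding krylov_def
  proof (rule span_minimal)
    show "subspace {x. Y x \<in> S}"
      using assms(1,2) by (auto simp: subspace_def endomorphism_iff endomorphism_0)
  qed (use assms(3,4) in auto)
  then show ?thesis using assms(5) by auto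
qed

lemma krylov_step:
  assumes "endomorphism X" "invariant X K" "x \<in> krylov K X v n"
  shows "X x \<in> krylov K X v (Suc n)"
proof (rule endomorphism_krylov[OF assms(1) subspace_krylov _ _ assms(3)])
  show "X ` K \<subseteq> krylov K X v (Suc n)"
    using assms(2) krylov_base by blast
  show "X ((X ^^ i) v) \<in> krylov K X v (Suc n)" if "i < n" for i
    using krylov_power[of "Suc i" "Suc n" X v K] that by simp
qed

lemma funpow_invariant: "invariant X S \<Longrightarrow> x \<in> S \<Longrightarrow> (X ^^ n) x \<in> S"
  by (induction n) auto

lemma krylov_subset:
  assumes "subspace U" "K \<subseteq> U" "invariant X U" "v \<in> U"
  shows "krylov K X v n \<subseteq> U"
  unfolding krylov_def by (rule span_minimal) (use assms funpow_invariant in auto)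

text \<open>If no power fell back into the span of the earlier ones, the \<open>n\<close>-th space
  would have dimension at least \<open>n\<close>, against the bound \<open>card F\<close>.\<close>

lemma krylov_stabilizes:
  assumes "subspace U" "K \<subseteq> U" "invariant X U" "v \<in> U" "U \<subseteq> span F" "finite F"
  obtains n where "(X ^^ n) v \<in> krylov K X v n"
proof (rule ccontr)
  assume "\<not> thesis"
  then have *: "(X ^^ n) v \<notin> krylov K X v n" for n
    using that by blast
  have sub: "krylov K X v n \<subseteq> U" for n
    using krylov_subset assms by blast
  have less: "dim (krylov K X v n) < dim (krylov K X v (Suc n))" for n
  proof (rule dim_strict_mono[OF subspace_krylov])
    show "krylov K X v n \<subset> krylov K X v (Suc n)"
      using * krylov_mono[of n "Suc n"] krylov_power[of n "Suc n"] by fastforce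
    show "krylov K X v (Suc n) \<subseteq> span F"
      using sub assms(5) by blast
  qed fact
  have "n \<le> dim (krylov K X v n)" for n
    by (induction n) (use less in \<open>auto simp: Suc_le_eq intro: le_less_trans\<close>)
  moreover have "dim (krylov K X v n) \<le> card F" for n
    using sub assms(5,6) by (meson dim_le_card subset_trans)
  ultimately show False
    by (meson Suc_n_not_le_n le_trans)
qed

subsection \<open>Weights modulo an invariant subspace\<close>

text \<open>The preimage in V of a simultaneous eigenspace in V/K. \<open>\<mu>\<close> is a bare
  function, so that an eigenvalue can be chosen separately for each operator.\<close>

definition weight_vectors :: "('v \<Rightarrow> 'v) set \<Rightarrow> (('v \<Rightarrow> 'v) \<Rightarrow> complex) \<Rightarrow> 'v set \<Rightarrow> 'v set"
  where "weight_vectors \<Y> \<mu> K = {v. \<forall>Y\<in>\<Y>. Y v - \<mu> Y *s v \<in> K}"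

lemma subspace_weight_vectors:
  assumes "subspace K" "\<And>Y. Y \<in> \<Y> \<Longrightarrow> endomorphism Y"
  shows "subspace (weight_vectors \<Y> \<mu> K)"
proof (rule subspaceI)
  show "0 \<in> weight_vectors \<Y> \<mu> K"
    using assms by (auto simp: weight_vectors_def endomorphism_0 subspace_0)
next
  fix x y assume xy: "x \<in> weight_vectors \<Y> \<mu> K" "y \<in> weight_vectors \<Y> \<mu> K"
  have "Y (x + y) - \<mu> Y *s (x + y) = (Y x - \<mu> Y *s x) + (Y y - \<mu> Y *s y)" if "Y \<in> \<Y>" for Y
    using assms(2)[OF that] by (simp add: endomorphism_add scale_right_distrib)
  then show "x + y \<in> weight_vectors \<Y> \<mu> K"
    using xy assms(1) by (auto simp: weight_vectors_def intro: subspace_add)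
next
  fix c x assume x: "x \<in> weight_vectors \<Y> \<mu> K"
  have "Y (c *s x) - \<mu> Y *s (c *s x) = c *s (Y x - \<mu> Y *s x)" if "Y \<in> \<Y>" for Y
    using assms(2)[OF that]
    by (simp add: endomorphism_scale scale_right_diff_distrib mult.commute)
  then show "c *s x \<in> weight_vectors \<Y> \<mu> K"
    using x assms(1) by (auto simp: weight_vectors_def intro: subspace_scale)
qed

lemma weight_vectors_base:
  assumes "subspace K" "\<And>Y. Y \<in> \<Y> \<Longrightarrow> invariant Y K" "x \<in> K"
  shows "x \<in> weight_vectors \<Y> \<mu> K"
  using assms by (auto simp: weight_vectors_def intro!: subspace_diff subspace_scale)

text \<open>Pulling \<open>Y\<close> through \<open>Suc n\<close> factors \<open>X\<close> leaves
  one bracket \<open>[Y, X]\<close> per factor, and each contributes \<open>\<mu> [Y, X]\<close>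
  times \<open>(X ^^ n) v\<close> up to lower terms; hence the integer coefficient. As
  \<open>krylov K X v n\<close> stops at exponent \<open>n - 1\<close>, both conclusions hold modulo
  \<open>K\<close> and powers below the \<open>n\<close>-th.\<close>

lemma weight_bracket_krylov:
  assumes K: "subspace K"
    and X: "endomorphism X" "invariant X K"
    and Y: "\<And>Y. Y \<in> \<Y> \<Longrightarrow> endomorphism Y" "\<And>Y. Y \<in> \<Y> \<Longrightarrow> invariant Y K"
      "\<And>Y. Y \<in> \<Y> \<Longrightarrow> lie_bracket Y X \<in> \<Y>"
    and v: "v \<in> weight_vectors \<Y> \<mu> K"
    and "Y \<in> \<Y>"
  shows "Y ((X ^^ n) v) - \<mu> Y *s (X ^^ n) v \<in> krylov K X v n"
    and "Y ((X ^^ Suc n) v) - \<mu> Y *s (X ^^ Suc n) v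
      - (of_nat (Suc n) * \<mu> (lie_bracket Y X)) *s (X ^^ n) v \<in> krylov K X v n"
proof -
  have comm: "Y (X u) = X (Y u) + lie_bracket Y X u" for Y u
    by (simp add: lie_bracket_def)
  \<comment> \<open>\<open>Y\<close> is generalized because moving it past one \<open>X\<close> also
    calls for the estimate for \<open>[Y, X]\<close>, which is again in \<open>\<Y>\<close>.\<close>
  have *: "Y ((X ^^ n) v) - \<mu> Y *s (X ^^ n) v \<in> krylov K X v n" if "Y \<in> \<Y>" for Y n
    using that
  proof (induction n arbitrary: Y)
    case 0
    then show ?case using v by (simp add: krylov_0[OF K] weight_vectors_def)
  next
    case (Suc n)
    let ?u = "(X ^^ n) v" and ?Z = "lie_bracket Y X"
    have "Y ((X ^^ Suc n) v) - \<mu> Y *s (X ^^ Suc n) v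
        = X (Y ?u - \<mu> Y *s ?u) + (?Z ?u - \<mu> ?Z *s ?u) + \<mu> ?Z *s ?u"
      using X(1) by (simp add: comm[of Y] endomorphism_diff endomorphism_scale)
    moreover have "X (Y ?u - \<mu> Y *s ?u) \<in> krylov K X v (Suc n)"
      using Suc krylov_step X by blast
    moreover have "?Z ?u - \<mu> ?Z *s ?u \<in> krylov K X v (Suc n)"
      using Suc Y(3) krylov_mono[of n "Suc n"] by fastforce
    moreover have "?u \<in> krylov K X v (Suc n)"
      by (simp add: krylov_power)
    ultimately show ?case
      by (metis subspace_add subspace_scale subspace_krylov)
  qed
  then show "Y ((X ^^ n) v) - \<mu> Y *s (X ^^ n) v \<in> krylov K X v n"
    using assms by blast
  show "Y ((X ^^ Suc n) v) - \<mu> Y *s (X ^^ Suc n) v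
      - (of_nat (Suc n) * \<mu> (lie_bracket Y X)) *s (X ^^ n) v \<in> krylov K X v n"
    using \<open>Y \<in> \<Y>\<close>
  proof (induction n)
    case 0
    let ?Z = "lie_bracket Y X"
    have "Y (X v) - \<mu> Y *s X v - \<mu> ?Z *s v
        = X (Y v - \<mu> Y *s v) + (?Z v - \<mu> ?Z *s v)"
      using X(1) by (simp add: comm[of Y] endomorphism_diff endomorphism_scale)
    moreover have "X (Y v - \<mu> Y *s v) \<in> K" "?Z v - \<mu> ?Z *s v \<in> K"
      using 0 v X Y(3) by (auto simp: weight_vectors_def)
    ultimately have "Y (X v) - \<mu> Y *s X v - \<mu> ?Z *s v \<in> K"
      using K by (metis subspace_add)
    then show ?case
      by (simp add: krylov_0[OF K])
  next
    case (Suc n)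
    let ?Z = "lie_bracket Y X" and ?u = "(X ^^ n) v"
    let ?a = "of_nat (Suc n) * \<mu> ?Z"
    have coeff: "of_nat (Suc (Suc n)) * \<mu> ?Z = ?a + \<mu> ?Z"
      by (simp add: algebra_simps)
    have arith: "a + z - b - (c + d) = (a - b - c) + (z - d)" for a b c d z :: 'v
      by simp
    have "Y ((X ^^ Suc (Suc n)) v) - \<mu> Y *s (X ^^ Suc (Suc n)) v
          - (of_nat (Suc (Suc n)) * \<mu> ?Z) *s (X ^^ Suc n) v
        = X (Y (X ?u) - \<mu> Y *s X ?u - ?a *s ?u) + (?Z (X ?u) - \<mu> ?Z *s X ?u)"
      using X(1)
      by (simp only: funpow.simps comp_apply comm[of Y "X ?u"] coeff scale_left_distrib
          endomorphism_diff endomorphism_scale arith)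
    moreover have "X (Y (X ?u) - \<mu> Y *s X ?u - ?a *s ?u) \<in> krylov K X v (Suc n)"
      using krylov_step[OF X] Suc by fastforce
    moreover have "?Z (X ?u) - \<mu> ?Z *s X ?u \<in> krylov K X v (Suc n)"
      using *[of ?Z "Suc n"] Suc Y(3) by simp
    ultimately show ?case
      by (metis subspace_add subspace_krylov)
  qed
qed

text \<open>Modulo \<open>K\<close>, the operator \<open>Y - \<mu> Y\<close> lowers the Krylov filtration generated by \<open>v\<close>, and
  on its top graded piece it acts as a positive integer times \<open>\<mu> [Y, X]\<close>; at the index where the
  filtration becomes stationary this forces \<open>\<mu> [Y, X] = 0\<close>. This replaces the usual trace
  computation.\<close>
lemma weight_bracket_eq_0:
  assumes K: "subspace K"
    and X: "endomorphism X" "invariant X K"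
    and Y: "\<And>Y. Y \<in> \<Y> \<Longrightarrow> endomorphism Y" "\<And>Y. Y \<in> \<Y> \<Longrightarrow> invariant Y K"
      "\<And>Y. Y \<in> \<Y> \<Longrightarrow> lie_bracket Y X \<in> \<Y>"
    and v: "v \<in> weight_vectors \<Y> \<mu> K" "v \<notin> K"
    and U: "subspace U" "K \<subseteq> U" "invariant X U" "v \<in> U" "U \<subseteq> span F" "finite F"
    and "Y \<in> \<Y>"
  shows "\<mu> (lie_bracket Y X) = 0"
proof -
  let ?T = "krylov K X v"
  \<comment> \<open>Minimality puts \<open>(X ^^ k) v\<close> outside \<open>?T k\<close> for the
    index \<open>k\<close> just before \<open>m\<close>, so a multiple of that vector lying in
    \<open>?T k\<close> has coefficient zero.\<close>
  define m where "m = (LEAST n. (X ^^ n) v \<in> ?T n)"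
  have m: "(X ^^ m) v \<in> ?T m"
    unfolding m_def by (rule LeastI_ex) (use krylov_stabilizes[OF U] in metis)
  have "m \<noteq> 0"
    using m v(2) krylov_0[OF K] by (metis funpow_0)
  then obtain k where k: "m = Suc k"
    using not0_implies_Suc by blast
  have not: "(X ^^ k) v \<notin> ?T k"
    using not_less_Least[of k "\<lambda>n. (X ^^ n) v \<in> ?T n"] k unfolding m_def by auto
  note filtration = weight_bracket_krylov[OF K X Y v(1) \<open>Y \<in> \<Y>\<close>]
  let ?N = "\<lambda>x. Y x - \<mu> Y *s x"
  have N: "endomorphism ?N"
    using Y(1)[OF \<open>Y \<in> \<Y>\<close>] by (auto simp: endomorphism_iff algebra_simps)
  \<comment> \<open>Stationarity expresses this power, modulo \<open>K\<close>, through the powers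
    up to the \<open>k\<close>-th, all of which \<open>?N\<close> sends into \<open>?T k\<close>.
    The image is thus one level lower than the filtration estimate alone gives.\<close>
  have "?N ((X ^^ Suc k) v) \<in> ?T k"
  proof (rule endomorphism_krylov[OF N subspace_krylov _ _ m[unfolded k]])
    show "?N ` K \<subseteq> ?T k"
      using Y(2)[OF \<open>Y \<in> \<Y>\<close>] K by (auto intro!: krylov_base subspace_diff subspace_scale)
    show "?N ((X ^^ i) v) \<in> ?T k" if "i < Suc k" for i
      using filtration(1)[of i] krylov_mono[of i k] that by fastforce
  qed
  then have "(of_nat (Suc k) * \<mu> (lie_bracket Y X)) *s (X ^^ k) v \<in> ?T k" (is "?c *s _ \<in> _")
    using subspace_diff[OF subspace_krylov _ filtration(2)[of k]] by fastforce
  then have "?c = 0"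
    using not subspace_scale_cancel[OF subspace_krylov] by blast
  \<comment> \<open>Characteristic zero enters here: \<open>of_nat (Suc k)\<close>, kept unexpanded,
    is recognized as nonzero.\<close>
  then show ?thesis
    by (simp del: of_nat_Suc)
qed

section \<open>Polynomials in an operator and eigenvectors modulo \<open>K\<close>\<close>

definition poly_op :: "('v \<Rightarrow> 'v) \<Rightarrow> complex poly \<Rightarrow> 'v \<Rightarrow> 'v"
  where "poly_op X p v = (\<Sum>i\<le>degree p. coeff p i *s (X ^^ i) v)"

lemma poly_op_altdef:
  assumes "degree p \<le> n"
  shows "poly_op X p v = (\<Sum>i\<le>n. coeff p i *s (X ^^ i) v)"
  unfolding poly_op_def
  by (rule sum.mono_neutral_left) (use assms in \<open>auto simp: coeff_eq_0\<close>)

lemma poly_op_add: "poly_op X (p + q) v = poly_op X p v + poly_op X q v"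
proof -
  let ?n = "max (degree p) (degree q)"
  have "degree (p + q) \<le> ?n"
    by (rule degree_add_le_max)
  then show ?thesis
    by (simp add: poly_op_altdef[of _ ?n] scale_left_distrib sum.distrib)
qed

lemma poly_op_smult: "poly_op X (smult c p) v = c *s poly_op X p v"
  by (simp add: poly_op_altdef[OF degree_smult_le] poly_op_def scale_sum_right)

lemma poly_op_diff: "poly_op X (p - q) v = poly_op X p v - poly_op X q v"
proof -
  have "p - q = p + smult (- 1) q"
    by simp
  then show ?thesis
    by (simp only: poly_op_add poly_op_smult) simp
qed

lemma poly_op_monom: "poly_op X (monom 1 n) v = (X ^^ n) v"
  by (simp add: poly_op_altdef[OF degree_monom_le] if_distrib[of "\<lambda>c. c *s _"] cong: if_cong)

lemma poly_op_linear_factor: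
  assumes "endomorphism X"
  shows "poly_op X ([:- c, 1:] * q) v = X (poly_op X q v) - c *s poly_op X q v"
proof -
  have "poly_op X (pCons 0 q) v = X (poly_op X q v)"
    using assms
    by (simp add: poly_op_altdef[OF degree_pCons_le] poly_op_def sum.atMost_Suc_shift
        endomorphism_sum endomorphism_scale del: sum.atMost_Suc)
  moreover have "[:- c, 1:] * q = pCons 0 q - smult c q"
    by simp
  ultimately show ?thesis
    by (simp only: poly_op_diff poly_op_smult)
qed

lemma poly_op_in:
  "subspace U \<Longrightarrow> invariant X U \<Longrightarrow> v \<in> U \<Longrightarrow> poly_op X p v \<in> U"
  unfolding poly_op_def by (intro subspace_sum subspace_scale funpow_invariant)

text \<open>The condition \<open>coeff p n = 0\<close> stands in for \<open>degree p < n\<close>: it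
  is linear in \<open>p\<close>, covers \<open>n = 0\<close> (where \<open>p = 0\<close> has degree
  0), and is enough to make \<open>monom 1 n - p\<close> a nonzero annihilating polynomial
  later.\<close>

lemma krylov_poly_op:
  assumes "subspace K" "x \<in> krylov K X v n"
  shows "\<exists>p. coeff p n = 0 \<and> x - poly_op X p v \<in> K"
proof -
  let ?S = "{x. \<exists>p. coeff p n = 0 \<and> x - poly_op X p v \<in> K}"
  have 0: "poly_op X 0 v = 0"
    using poly_op_smult[of X 0 0] by simp
  have "krylov K X v n \<subseteq> ?S"
    unfolding krylov_def
  proof (rule span_minimal)
    show "K \<union> (\<lambda>i. (X ^^ i) v) ` {..<n} \<subseteq> ?S"
    proof
      fix x assume "x \<in> K \<union> (\<lambda>i. (X ^^ i) v) ` {..<n}"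
      then consider "x \<in> K" | i where "i < n" "x = (X ^^ i) v"
        by auto
      then show "x \<in> ?S"
      proof cases
        case 1
        then show ?thesis by (auto intro!: exI[of _ 0] simp: 0)
      next
        case 2
        then show ?thesis
          using assms(1) by (auto intro!: exI[of _ "monom 1 i"] simp: poly_op_monom subspace_0)
      qed
    qed
    show "subspace ?S"
    proof (rule subspaceI)
      show "0 \<in> ?S"
        using assms(1) by (auto intro!: exI[of _ 0] simp: 0 subspace_0)
    next
      fix x y assume "x \<in> ?S" "y \<in> ?S"
      then obtain p q where pq: "coeff p n = 0" "x - poly_op X p v \<in> K"
        "coeff q n = 0" "y - poly_op X q v \<in> K"
        by blast
      have "x + y - poly_op X (p + q) v = (x - poly_op X p v) + (y - poly_op X q v)"
        by (simp add: poly_op_add)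
      then have "x + y - poly_op X (p + q) v \<in> K"
        using pq subspace_add[OF assms(1)] by metis
      then show "x + y \<in> ?S"
        using pq(1,3) by (auto intro!: exI[of _ "p + q"])
    next
      fix c x assume "x \<in> ?S"
      then obtain p where p: "coeff p n = 0" "x - poly_op X p v \<in> K"
        by blast
      have "c *s x - poly_op X (smult c p) v = c *s (x - poly_op X p v)"
        by (simp add: poly_op_smult scale_right_diff_distrib)
      then have "c *s x - poly_op X (smult c p) v \<in> K"
        using p subspace_scale[OF assms(1)] by metis
      then show "c *s x \<in> ?S"
        using p(1) by (auto intro!: exI[of _ "smult c p"])
    qed
  qed
  then show ?thesis using assms(2) by auto
qed

text \<open>Split off one root \<open>c\<close> of \<open>p\<close> at a time, leaving a quotient
  \<open>q\<close>. Either \<open>q(X) v\<close> still lies in \<open>K\<close>, and the degree has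
  dropped, or it is itself an eigenvector modulo \<open>K\<close>. A nonzero constant cannot be
  reached, since it would put \<open>v\<close> into \<open>K\<close>.\<close>

lemma eigenvector_of_poly:
  assumes "endomorphism X" "subspace K" "subspace U" "invariant X U" "v \<in> U" "v \<notin> K"
    and "p \<noteq> 0" "poly_op X p v \<in> K"
  shows "\<exists>u c. u \<in> U \<and> u \<notin> K \<and> X u - c *s u \<in> K"
  using assms(7,8)
proof (induction "degree p" arbitrary: p)
  case 0
  then have "coeff p 0 *s v \<in> K" "coeff p 0 \<noteq> 0"
    by (auto simp: poly_op_def elim: degree_eq_zeroE)
  then show ?case
    using subspace_scale_cancel assms(2,6) by blast
next
  case (Suc n)
  then have "\<not> constant (poly p)"
    by (simp add: constant_degree)
  then obtain c where "poly p c = 0"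
    using fundamental_theorem_of_algebra by blast
  then obtain q where q: "p = [:- c, 1:] * q"
    by (auto simp: poly_eq_0_iff_dvd)
  with Suc.prems have "q \<noteq> 0" by auto
  then have "degree p = Suc (degree q)"
    unfolding q by (subst degree_mult_eq) auto
  show ?case
  proof (cases "poly_op X q v \<in> K")
    case True
    then show ?thesis
      using Suc \<open>q \<noteq> 0\<close> \<open>degree p = Suc (degree q)\<close> by simp
  next
    case False
    then show ?thesis
      using Suc.prems(2) poly_op_in[OF assms(3,4,5), of q]
      unfolding q poly_op_linear_factor[OF assms(1)] by blast
  qed
qed

lemma eigenvector_modulo:
  assumes "endomorphism X" "subspace K" "subspace U" "K \<subset> U" "invariant X U"
    and "U \<subseteq> span F" "finite F"
  obtains u c where "u \<in> U" "u \<notin> K" "X u - c *s u \<in> K"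
proof -
  obtain v where v: "v \<in> U" "v \<notin> K"
    using assms(4) by blast
  obtain n where "(X ^^ n) v \<in> krylov K X v n"
    using krylov_stabilizes assms v(1) by (metis psubset_imp_subset)
  then obtain p where p: "coeff p n = 0" "(X ^^ n) v - poly_op X p v \<in> K"
    using krylov_poly_op[OF assms(2)] by blast
  have "monom 1 n - p \<noteq> 0"
    using p(1) by (metis coeff_monom eq_iff_diff_eq_0 zero_neq_one)
  moreover have "poly_op X (monom 1 n - p) v \<in> K"
    using p(2) by (simp add: poly_op_diff poly_op_monom)
  ultimately show thesis
    using eigenvector_of_poly assms v that by metis
qed

end

subsection \<open>The derived series\<close>

lemma derived_series_add:
  "derived_series s (derived_series s S m) n = derived_series s S (m + n)"
  by (induction n) auto

context complex_vector_space
begin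

abbreviation endo_scale :: "complex \<Rightarrow> ('v \<Rightarrow> 'v) \<Rightarrow> 'v \<Rightarrow> 'v"
  where "endo_scale c X \<equiv> \<lambda>u. c *s X u"

lemma vector_space_endo_scale: "vector_space endo_scale"
  by unfold_locales (auto simp: fun_eq_iff scale_right_distrib scale_left_distrib)

text \<open>Gives sets of operators the library theory of span, independence and bases, in place of
  the intersections in \<open>endo_span\<close>.\<close>

sublocale endo: vector_space endo_scale
  by (rule vector_space_endo_scale)

lemma endo_subspace_iff: "endo_subspace scale S \<longleftrightarrow> endo.subspace S"
  by (simp add: endo_subspace_def endo.subspace_def zero_fun_def plus_fun_def)

lemma endo_span_eq: "endo_span scale A = endo.span A"
  by (simp add: endo_span_def endo.span_def hull_def endo_subspace_iff)

text \<open>The ambient space of \<open>endo\<close> contains all maps from V to V, so linearity is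
  recorded separately. The pairing is absent, which keeps Lie's theorem a statement about V
  alone.\<close>

definition bracket_closed :: "('v \<Rightarrow> 'v) set \<Rightarrow> bool"
  where "bracket_closed S \<longleftrightarrow> endo.subspace S \<and> (\<forall>X\<in>S. endomorphism X)
    \<and> (\<forall>X\<in>S. \<forall>Y\<in>S. lie_bracket X Y \<in> S)"

lemma derived_series_Suc_endo:
  "derived_series scale S (Suc n) = endo.span {lie_bracket X Y | X Y.
     X \<in> derived_series scale S n \<and> Y \<in> derived_series scale S n}"
  by (simp add: endo_span_eq)

lemma derived_series_subset:
  assumes "endo.subspace S" "\<forall>X\<in>S. \<forall>Y\<in>S. lie_bracket X Y \<in> S"
  shows "derived_series scale S n \<subseteq> S"
proof (induction n)
  case (Suc n)
  then show ?case
    unfolding derived_series_Suc_endo using assms by (intro endo.span_minimal) blast+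
qed simp

lemma subspace_derived_series:
  "endo.subspace S \<Longrightarrow> endo.subspace (derived_series scale S n)"
  by (cases n) (simp_all add: derived_series_Suc_endo del: derived_series.simps(2))

lemma lie_bracket_derived:
  "X \<in> derived_series scale S n \<Longrightarrow> Y \<in> derived_series scale S n \<Longrightarrow>
    lie_bracket X Y \<in> derived_series scale S (Suc n)"
  unfolding derived_series_Suc_endo by (rule endo.span_base) blast

lemma bracket_closed_derived:
  assumes "bracket_closed S"
  shows "bracket_closed (derived_series scale S n)"
proof -
  have sub: "derived_series scale S n \<subseteq> S"
    using assms derived_series_subset unfolding bracket_closed_def by blast
  moreover have "derived_series scale S (Suc n) \<subseteq> derived_series scale S n"
    using assms
  proof (induction n)
    case 0
    then show ?case
      using derived_series_subset[of S 1] unfolding bracket_closed_def by simp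
  next
    case (Suc n)
    then show ?case
      unfolding derived_series_Suc_endo[of S "Suc n"] derived_series_Suc_endo[of S n]
      by (intro endo.span_mono) (use Suc in \<open>auto simp del: derived_series.simps(2)\<close>)
  qed
  ultimately show ?thesis
    using assms lie_bracket_derived subspace_derived_series
    unfolding bracket_closed_def by blast
qed

subsection \<open>Lie's theorem modulo an invariant subspace\<close>

text \<open>\<open>Y X x = X Y x + [Y, X] x\<close>, and the last term falls into \<open>K\<close>
  because the weight vanishes on it. The brackets get their own family \<open>\<Y>'\<close> since
  the lemma serves both the derived algebra and a single operator whose brackets only lie in the
  derived algebra.\<close>

lemma invariant_weight_vectors:
  assumes "subspace K" "endomorphism X" "invariant X K" "invariant X U"
    and "\<And>Y. Y \<in> \<Y> \<Longrightarrow> lie_bracket Y X \<in> \<Y>'" "\<And>Y. Y \<in> \<Y> \<Longrightarrow> \<mu> (lie_bracket Y X) = 0"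
    and "x \<in> U" "x \<in> weight_vectors \<Y> \<mu> K" "x \<in> weight_vectors \<Y>' \<mu> K"
  shows "X x \<in> U \<inter> weight_vectors \<Y> \<mu> K"
proof -
  have "Y (X x) - \<mu> Y *s X x \<in> K" if Y: "Y \<in> \<Y>" for Y
  proof -
    have "Y (X x) - \<mu> Y *s X x = X (Y x - \<mu> Y *s x) + lie_bracket Y X x"
      using assms(2) by (simp add: endomorphism_diff endomorphism_scale lie_bracket_def)
    moreover have "X (Y x - \<mu> Y *s x) \<in> K"
      using assms(3,8) Y by (auto simp: weight_vectors_def)
    moreover have "lie_bracket Y X x \<in> K"
      using assms(5,6,9) Y by (fastforce simp: weight_vectors_def)
    ultimately show ?thesis
      using subspace_add[OF assms(1)] by metis
  qed
  then show ?thesis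
    using assms(4,7) by (auto simp: weight_vectors_def)
qed

text \<open>Induction on the derived length. Let \<open>W\<close> be an invariant subspace of least
  dimension strictly above \<open>K\<close>, so that W/K is a simple module. The derived algebra
  \<open>D\<close> has a weight vector in \<open>W\<close> by induction, its weight space is
  invariant and hence all of \<open>W\<close>; then the eigenspace in \<open>W\<close> of each
  \<open>X\<close> is invariant for the same reason. So all of \<open>S\<close> acts on W/K by
  scalars. Simplicity replaces the ideal of codimension one of the textbook proof.\<close>

lemma lie_theorem:
  assumes "bracket_closed S" "derived_series scale S n = {\<lambda>_. 0}"
    and "subspace K" "\<And>X. X \<in> S \<Longrightarrow> invariant X K"
    and "subspace U" "\<And>X. X \<in> S \<Longrightarrow> invariant X U"
    and "K \<subset> U" "U \<subseteq> span F" "finite F"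
  obtains u where "u \<in> U" "u \<notin> K" "\<And>X. X \<in> S \<Longrightarrow> \<exists>c. X u - c *s u \<in> K"
proof -
  have "\<exists>u\<in>U - K. \<forall>X\<in>S. \<exists>c. X u - c *s u \<in> K"
    using assms(1,2,4-8)
  proof (induction n arbitrary: S U)
    case 0
    then obtain u where "u \<in> U" "u \<notin> K" by blast
    moreover have "X u - 0 *s u \<in> K" if "X \<in> S" for X
      using that "0.prems"(2) assms(3) by (simp add: subspace_0)
    ultimately show ?case by blast
  next
    case (Suc n)
    define good where "good W \<longleftrightarrow> subspace W \<and> (\<forall>X\<in>S. invariant X W) \<and> K \<subset> W \<and> W \<subseteq> U" for W
    have "good U"
      using Suc.prems by (auto simp: good_def)
    then obtain W where W: "good W" "\<And>W'. good W' \<Longrightarrow> dim W \<le> dim W'"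
      by (metis ex_has_least_nat)
    then have sW: "subspace W" "\<And>X. X \<in> S \<Longrightarrow> invariant X W" "K \<subset> W" "W \<subseteq> span F"
      using Suc.prems(7) unfolding good_def by blast+
    have minimal: "W' = W" if "subspace W'" "\<And>X. X \<in> S \<Longrightarrow> invariant X W'" "K \<subseteq> W'" "W' \<subseteq> W"
      "u \<in> W'" "u \<notin> K" for W' u
    proof (rule ccontr)
      assume "W' \<noteq> W"
      then have "dim W' < dim W"
        using that sW(4) assms(9) by (intro dim_strict_mono) auto
      moreover have "good W'"
        using that W(1) by (auto simp: good_def)
      ultimately show False
        using W(2) by (simp add: leD)
    qed
    have S: "endo.subspace S" "\<And>X. X \<in> S \<Longrightarrow> endomorphism X"
      "\<And>X Y. X \<in> S \<Longrightarrow> Y \<in> S \<Longrightarrow> lie_bracket X Y \<in> S"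
      using Suc.prems(1) by (auto simp: bracket_closed_def)
    define D where "D = derived_series scale S 1"
    have D_sub: "D \<subseteq> S"
      unfolding D_def using derived_series_subset S by blast
    have D: "lie_bracket X Y \<in> D" if "X \<in> S" "Y \<in> S" for X Y
      unfolding D_def using lie_bracket_derived[of X S 0 Y] that by simp
    have D_endo: "\<And>Y. Y \<in> D \<Longrightarrow> endomorphism Y" "\<And>Y. Y \<in> D \<Longrightarrow> invariant Y K"
      using D_sub S(2) Suc.prems(3) by blast+
    have "\<exists>u\<in>W - K. \<forall>X\<in>D. \<exists>c. X u - c *s u \<in> K"
    proof (rule Suc.IH)
      show "bracket_closed D"
        unfolding D_def by (rule bracket_closed_derived) fact
      show "derived_series scale D n = {\<lambda>_. 0}"
        using Suc.prems(2) unfolding D_def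
        by (simp only: derived_series_add add.commute[of 1] Suc_eq_plus1)
    qed (use sW D_sub Suc.prems in blast)+
    then obtain v \<mu> where v: "v \<in> W" "v \<notin> K" "v \<in> weight_vectors D \<mu> K"
      unfolding weight_vectors_def by (auto dest!: bchoice)
    have W_weight: "W \<inter> weight_vectors D \<mu> K = W"
    proof (rule minimal)
      show "subspace (W \<inter> weight_vectors D \<mu> K)"
        by (intro subspace_inter subspace_weight_vectors sW(1) assms(3) D_endo)
      show "K \<subseteq> W \<inter> weight_vectors D \<mu> K"
        using sW(3) weight_vectors_base[OF assms(3) D_endo(2)] by blast
      show "invariant X (W \<inter> weight_vectors D \<mu> K)" if X: "X \<in> S" for X
      proof -
        have zero: "\<mu> (lie_bracket Y X) = 0" if "Y \<in> D" for Y
          by (rule weight_bracket_eq_0[OF assms(3) S(2)[OF X] Suc.prems(3)[OF X] _ _ _ v(3,2) sW(1)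
                _ sW(2)[OF X] v(1) sW(4) assms(9) that])
            (erule D_endo | use X D D_sub sW(3) in blast)+
        have "X x \<in> W \<inter> weight_vectors D \<mu> K" if "x \<in> W \<inter> weight_vectors D \<mu> K" for x
          by (rule invariant_weight_vectors[OF assms(3) S(2)[OF X] Suc.prems(3)[OF X] sW(2)[OF X],
                where \<Y>' = D]) (erule zero | use that X D D_sub in blast)+
        then show ?thesis by blast
      qed
    qed (use v in auto)
    have scalar: "\<exists>c. \<forall>w\<in>W. X w - c *s w \<in> K" if X: "X \<in> S" for X
    proof -
      obtain u c where u: "u \<in> W" "u \<notin> K" "X u - c *s u \<in> K"
        using eigenvector_modulo[of X K W F] X S sW assms(3,9) by blast
      \<comment> \<open>Extends the weight \<open>\<mu>\<close> from \<open>D\<close> to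
        \<open>insert X D\<close> by the eigenvalue \<open>c\<close>; the guard
        \<open>X \<notin> D\<close> keeps it equal to \<open>\<mu>\<close> on
        \<open>D\<close>.\<close>
      define \<nu> where "\<nu> Y = (if Y = X \<and> X \<notin> D then c else \<mu> Y)" for Y
      have D_weight: "w \<in> weight_vectors D \<nu> K" if "w \<in> W" for w
        using W_weight that by (auto simp: weight_vectors_def \<nu>_def)
      show ?thesis
      proof (cases "X \<in> D")
        case True
        then show ?thesis
          using W_weight by (auto simp: weight_vectors_def)
      next
        case False
        then have \<nu>_X: "\<nu> X = c"
          by (simp add: \<nu>_def)
        have "W \<inter> weight_vectors {X} \<nu> K = W"
        proof (rule minimal)
          show "subspace (W \<inter> weight_vectors {X} \<nu> K)"
            using S(2)[OF X] by (intro subspace_inter subspace_weight_vectors sW(1) assms(3)) simp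
          show "K \<subseteq> W \<inter> weight_vectors {X} \<nu> K"
            using sW(3) weight_vectors_base[OF assms(3), of "{X}"] Suc.prems(3)[OF X] by blast
          show "u \<in> W \<inter> weight_vectors {X} \<nu> K"
            using u by (simp add: weight_vectors_def \<nu>_X)
          show "invariant X' (W \<inter> weight_vectors {X} \<nu> K)" if X': "X' \<in> S" for X'
          proof -
            \<comment> \<open>\<open>{X}\<close> alone need not be stable under brackets with
              \<open>X'\<close>, but \<open>insert X D\<close> is, because all brackets land in
              \<open>D\<close>.\<close>
            have u': "u \<in> weight_vectors (insert X D) \<nu> K"
              using u D_weight by (simp add: weight_vectors_def \<nu>_X)
            have ins: "\<And>Y. Y \<in> insert X D \<Longrightarrow> endomorphism Y"
              "\<And>Y. Y \<in> insert X D \<Longrightarrow> invariant Y K"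
              using D_endo S(2)[OF X] Suc.prems(3)[OF X] by blast+
            have zero: "\<nu> (lie_bracket X X') = 0"
              by (rule weight_bracket_eq_0[OF assms(3) S(2)[OF X'] Suc.prems(3)[OF X'] _ _ _ u' u(2)
                    sW(1) _ sW(2)[OF X'] u(1) sW(4) assms(9)])
                (erule ins | use X X' D D_sub sW(3) in blast)+
            have "X' x \<in> W \<inter> weight_vectors {X} \<nu> K" if "x \<in> W \<inter> weight_vectors {X} \<nu> K" for x
              by (rule invariant_weight_vectors[OF assms(3) S(2)[OF X'] Suc.prems(3)[OF X']
                    sW(2)[OF X'], where \<Y>' = D])
                (use that X X' D zero D_weight in \<open>fastforce\<close>)+
            then show ?thesis by blast
          qed
        qed (use u in auto)
        then show ?thesis
          by (auto simp: weight_vectors_def \<nu>_X)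
      qed
    qed
    moreover have "v \<in> U - K"
      using v W(1) by (auto simp: good_def)
    ultimately show ?case
      using v(1) by blast
  qed
  then show thesis using that by blast
qed

text \<open>A basis of \<open>W\<close> compatible with a complete flag of invariant subspaces, built greedily
  from the bottom.\<close>
lemma triangular_basis:
  assumes "bracket_closed S" "derived_series scale S n = {\<lambda>_. 0}"
    and "subspace W" "\<And>X. X \<in> S \<Longrightarrow> invariant X W" "W \<subseteq> span F" "finite F"
    and "X \<in> S" "Y \<in> S" "nilpotent_endo Y"
  obtains B where "finite B" "independent B" "span B = W" "\<And>e. e \<in> B \<Longrightarrow> X (Y e) \<in> span (B - {e})"
proof -
  \<comment> \<open>The last clause says that the diagonal entry of \<open>XY\<close> at
    \<open>e\<close> vanishes, which is what the trace requires. Unlike a triangular matrix it needs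
    no ordering of \<open>B\<close>, and it survives enlarging \<open>B\<close>.\<close>
  define good where "good B \<longleftrightarrow> finite B \<and> independent B \<and> B \<subseteq> W \<and> (\<forall>Z\<in>S. invariant Z (span B))
    \<and> (\<forall>e\<in>B. X (Y e) \<in> span (B - {e}))" for B
  have S: "\<And>X. X \<in> S \<Longrightarrow> endomorphism X"
    using assms(1) by (auto simp: bracket_closed_def)
  have "good {}"
    using S by (auto simp: good_def endomorphism_0 independent_empty)
  moreover have "card B < Suc (card F)" if "good B" for B
    using that independent_span_bound[OF assms(6), of B] assms(5) by (fastforce simp: good_def less_Suc_eq_le)
  ultimately obtain B where B: "good B" "\<And>B'. good B' \<Longrightarrow> card B' \<le> card B"
    using ex_has_greatest_nat[of good "{}" card "Suc (card F)"] by (metis le_less)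
  have "span B = W"
  proof (rule ccontr)
    assume "span B \<noteq> W"
    then have "span B \<subset> W"
      using B(1) span_minimal[of B W] assms(3) by (auto simp: good_def)
    moreover have "\<And>Z. Z \<in> S \<Longrightarrow> invariant Z (span B)"
      using B(1) by (auto simp: good_def)
    ultimately obtain u where u: "u \<in> W" "u \<notin> span B" "\<And>Z. Z \<in> S \<Longrightarrow> \<exists>c. Z u - c *s u \<in> span B"
      using lie_theorem[OF assms(1,2) subspace_span _ assms(3,4) _ assms(5,6)] by metis
    obtain c where c: "Y u - c *s u \<in> span B"
      using u(3) assms(8) by blast
    \<comment> \<open>Nilpotency kills the eigenvalue: if \<open>Y ^^ k\<close> is zero, then
      \<open>c ^ k *s u\<close> lies in \<open>span B\<close> although \<open>u\<close> does
      not.\<close>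
    have "(Y ^^ k) u - c ^ k *s u \<in> span B" for k
    proof (induction k)
      case (Suc k)
      have "(Y ^^ Suc k) u - c ^ Suc k *s u = Y ((Y ^^ k) u - c ^ k *s u) + c ^ k *s (Y u - c *s u)"
        using S[OF assms(8)]
        by (simp add: endomorphism_diff endomorphism_scale scale_right_diff_distrib mult.commute)
      moreover have "Y ((Y ^^ k) u - c ^ k *s u) \<in> span B"
        using Suc B(1) assms(8) by (auto simp: good_def)
      ultimately show ?case
        using c by (metis span_add span_scale)
    qed (simp add: span_zero)
    moreover obtain k where "Y ^^ k = (\<lambda>_. 0)"
      using assms(9) by (auto simp: nilpotent_endo_def)
    ultimately have "- (c ^ k *s u) \<in> span B"
      by (metis diff_0)
    then have "c ^ k *s u \<in> span B"
      using span_neg by fastforce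
    then have "c ^ k = 0"
      using u(2) subspace_scale_cancel[OF subspace_span] by blast
    then have "Y u \<in> span B"
      using c by simp
    then have XYu: "X (Y u) \<in> span B"
      using B(1) assms(7) by (auto simp: good_def)
    have "u \<notin> B"
      using u(2) span_base by blast
    have "good (insert u B)"
      unfolding good_def
    proof (intro conjI ballI)
      show "finite (insert u B)" "independent (insert u B)" "insert u B \<subseteq> W"
        using B(1) u independent_insertI[OF u(2)] by (auto simp: good_def)
      fix Z assume Z: "Z \<in> S"
      have "span (insert u B) \<subseteq> {x. Z x \<in> span (insert u B)}"
      proof (rule span_minimal)
        obtain d where "Z u - d *s u \<in> span B"
          using u(3) Z by blast
        then have "Z u \<in> span (insert u B)"
          using span_breakdown_eq by blast
        moreover have "Z e \<in> span (insert u B)" if "e \<in> B" for e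
          using B(1) Z that span_base[of e B] span_mono[of B "insert u B"] unfolding good_def by blast
        ultimately show "insert u B \<subseteq> {x. Z x \<in> span (insert u B)}"
          by blast
        show "subspace {x. Z x \<in> span (insert u B)}"
          using S[OF Z] by (auto intro!: subspaceI span_add span_scale span_zero
              simp: endomorphism_0 endomorphism_add endomorphism_scale)
      qed
      then show "invariant Z (span (insert u B))"
        by blast
    next
      fix e assume "e \<in> insert u B"
      then consider "e = u" | "e \<in> B" by blast
      then show "X (Y e) \<in> span (insert u B - {e})"
      proof cases
        case 1
        then show ?thesis using XYu \<open>u \<notin> B\<close> by simp
      next
        case 2
        then show ?thesis
          using B(1) span_mono[of "B - {e}" "insert u B - {e}"] unfolding good_def by blast
      qed
    qed
    moreover have "card (insert u B) = Suc (card B)"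
      using B(1) \<open>u \<notin> B\<close> by (simp add: good_def)
    ultimately show False
      using B(2) by fastforce
  qed
  then show thesis
    using that B(1) by (auto simp: good_def)
qed

end

subsection \<open>The Lie algebra of a pairing and its trace\<close>

locale pairing_space = complex_vector_space scale
  for scale :: "complex \<Rightarrow> 'v \<Rightarrow> 'v::ab_group_add" (infixr \<open>*s\<close> 75) +
  fixes pr :: "'v \<Rightarrow> 'w \<Rightarrow> complex"
  assumes pr_add: "pr (x + y) w = pr x w + pr y w"
    and pr_scale: "pr (c *s x) w = c * pr x w"
begin

lemma pr_0: "pr 0 w = 0"
  using pr_scale[of 0 0 w] by simp

lemma pr_sum: "pr (sum f A) w = (\<Sum>i\<in>A. pr (f i) w)"
  by (induction A rule: infinite_finite_induct) (simp_all add: pr_add pr_0)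

lemma tensor_op_Nil: "tensor_op scale pr [] = 0"
  by (simp add: tensor_op_def fun_eq_iff)

lemma tensor_op_Cons: "tensor_op scale pr ((v, w) # ps) u = pr u w *s v + tensor_op scale pr ps u"
  by (simp add: tensor_op_def)

lemma tensor_op_append:
  "tensor_op scale pr (ps @ qs) = tensor_op scale pr ps + tensor_op scale pr qs"
  by (simp add: tensor_op_def fun_eq_iff)

lemma endomorphism_tensor_op: "endomorphism (tensor_op scale pr ps)"
proof (induction ps)
  case Nil
  then show ?case by (simp add: tensor_op_Nil endomorphism_iff)
next
  case (Cons p ps)
  then show ?case
    by (cases p) (simp add: endomorphism_iff tensor_op_Cons pr_add pr_scale scale_left_distrib
        scale_right_distrib add.left_commute add.assoc)
qed

lemma gl_endomorphism: "X \<in> gl scale pr \<Longrightarrow> endomorphism X"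
  by (auto simp: gl_def endomorphism_tensor_op)

lemma comp_tensor_op:
  assumes "endomorphism X"
  shows "X \<circ> tensor_op scale pr ps = tensor_op scale pr (map (\<lambda>(v, w). (X v, w)) ps)"
proof
  show "(X \<circ> tensor_op scale pr ps) u
      = tensor_op scale pr (map (\<lambda>(v, w). (X v, w)) ps) u" for u
  proof (induction ps)
    case Nil
    then show ?case using assms by (simp add: tensor_op_Nil endomorphism_0)
  next
    case (Cons p ps)
    then show ?case
      using assms by (cases p) (simp add: tensor_op_Cons endomorphism_add endomorphism_scale)
  qed
qed

lemma tensor_op_in_span: "tensor_op scale pr ps u \<in> span (fst ` set ps)"
proof (induction ps)
  case Nil
  then show ?case by (simp add: tensor_op_Nil)
next
  case (Cons p ps)
  have "pr u (snd p) *s fst p \<in> span (fst ` set (p # ps))"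
    by (simp add: span_base span_scale)
  moreover have "tensor_op scale pr ps u \<in> span (fst ` set (p # ps))"
    using Cons span_mono[of "fst ` set ps" "fst ` set (p # ps)"] by auto
  ultimately show ?case
    using span_add tensor_op_Cons[of "fst p" "snd p"] by simp
qed

lemma endo_scale_tensor_op:
  "endo_scale c (tensor_op scale pr ps) = tensor_op scale pr (map (\<lambda>(v, w). (c *s v, w)) ps)"
  using comp_tensor_op[of "\<lambda>v. c *s v" ps]
  by (simp add: endomorphism_iff scale_right_distrib scale_left_commute comp_def)

lemma subspace_gl: "endo.subspace (gl scale pr)"
proof (rule endo.subspaceI)
  show "0 \<in> gl scale pr"
    unfolding gl_def using tensor_op_Nil by fastforce
  show "X + Y \<in> gl scale pr" if "X \<in> gl scale pr" "Y \<in> gl scale pr" for X Y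
    using that unfolding gl_def by (auto simp: tensor_op_append[symmetric])
  show "endo_scale c X \<in> gl scale pr" if "X \<in> gl scale pr" for c X
    using that unfolding gl_def by (auto simp: endo_scale_tensor_op)
qed

lemma gl_comp: "X \<in> gl scale pr \<Longrightarrow> Y \<in> gl scale pr \<Longrightarrow> X \<circ> Y \<in> gl scale pr"
  using comp_tensor_op[OF gl_endomorphism] by (fastforce simp: gl_def)

lemma lie_bracket_eq: "lie_bracket X Y = (X \<circ> Y) - (Y \<circ> X)"
  by (simp add: lie_bracket_def fun_eq_iff)

lemma bracket_closed_gl: "bracket_closed (gl scale pr)"
  unfolding bracket_closed_def lie_bracket_eq
  by (auto intro: subspace_gl gl_endomorphism endo.subspace_diff gl_comp)

lemma subalgebra_iff: "subalgebra scale pr S \<longleftrightarrow> S \<subseteq> gl scale pr \<and> bracket_closed S"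
  unfolding subalgebra_def bracket_closed_def endo_subspace_iff using gl_endomorphism by blast

text \<open>Expand each \<open>v\<close> in the basis \<open>B\<close> and use linearity of
  \<open>pr\<close>. The right-hand side depends on the operator and not on the list
  \<open>ps\<close>, which both makes \<open>tr\<close> well defined and identifies it with a sum of
  diagonal entries.\<close>

lemma sum_pr_eq:
  assumes "finite B" "independent B" "fst ` set ps \<subseteq> span B"
  shows "sum_list (map (\<lambda>(v, w). pr v w) ps)
    = (\<Sum>e\<in>B. representation B (tensor_op scale pr ps e) e)"
  using assms(3)
proof (induction ps)
  case Nil
  then show ?case by (simp add: tensor_op_Nil representation_zero)
next
  case (Cons p ps)
  obtain v w where p: "p = (v, w)" by fastforce
  have v: "v \<in> span B" and ps: "fst ` set ps \<subseteq> span B"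
    using Cons.prems p by auto
  have "tensor_op scale pr ps e \<in> span B" for e
    using tensor_op_in_span[of ps e] span_minimal[OF ps subspace_span] by blast
  then have "representation B (tensor_op scale pr (p # ps) e) e
      = pr e w * representation B v e + representation B (tensor_op scale pr ps e) e" for e
    using assms(2) v by (simp add: p tensor_op_Cons representation_add representation_scale span_scale)
  moreover have "pr v w = (\<Sum>e\<in>B. pr e w * representation B v e)"
  proof -
    have "v = (\<Sum>e\<in>B. representation B v e *s e)"
      using sum_representation_eq[OF assms(2) v assms(1)] by simp
    then have "pr v w = pr (\<Sum>e\<in>B. representation B v e *s e) w"
      by simp
    then show ?thesis
      by (simp add: pr_sum pr_scale mult.commute)
  qed
  ultimately show ?case
    using Cons.IH[OF ps] by (simp add: p sum.distrib)
qed

text \<open>Resolves the definite description in \<open>tr\<close>: two tensors of the same operator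
  are compared in one basis spanning the vectors of both.\<close>

lemma tr_tensor_op: "tr scale pr (tensor_op scale pr ps) = sum_list (map (\<lambda>(v, w). pr v w) ps)"
  unfolding tr_def
proof (rule the_equality)
  fix c
  assume "\<exists>qs. tensor_op scale pr ps = tensor_op scale pr qs
    \<and> c = sum_list (map (\<lambda>(v, w). pr v w) qs)"
  then obtain qs where qs: "tensor_op scale pr ps = tensor_op scale pr qs"
    "c = sum_list (map (\<lambda>(v, w). pr v w) qs)"
    by blast
  let ?A = "fst ` set ps \<union> fst ` set qs"
  obtain B where B: "B \<subseteq> ?A" "independent B" "?A \<subseteq> span B"
    using maximal_independent_subset by metis
  moreover have "finite B"
    using B(1) by (rule finite_subset) simp
  ultimately show "c = sum_list (map (\<lambda>(v, w). pr v w) ps)"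
    using sum_pr_eq[of B ps] sum_pr_eq[of B qs] qs by simp
qed blast

section \<open>Generated subalgebras and vanishing of the trace\<close>

lemma subalgebra_gl: "subalgebra scale pr (gl scale pr)"
  using bracket_closed_gl by (simp add: subalgebra_iff)

lemma generated_subset: "F \<subseteq> generated_subalgebra scale pr F"
  by (auto simp: generated_subalgebra_def)

lemma generated_minimal:
  "subalgebra scale pr S \<Longrightarrow> F \<subseteq> S \<Longrightarrow> generated_subalgebra scale pr F \<subseteq> S"
  by (auto simp: generated_subalgebra_def)

text \<open>The assumption makes the intersected family nonempty, \<open>gl\<close> being a member;
  an empty family would give the set of all maps.\<close>

lemma subalgebra_generated:
  assumes "F \<subseteq> gl scale pr"
  shows "subalgebra scale pr (generated_subalgebra scale pr F)"
proof -
  have "generated_subalgebra scale pr F \<subseteq> gl scale pr"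
    by (rule generated_minimal[OF subalgebra_gl assms])
  moreover have "bracket_closed (generated_subalgebra scale pr F)"
    using calculation unfolding bracket_closed_def
  proof (intro conjI ballI)
    show "endo.subspace (generated_subalgebra scale pr F)"
      unfolding generated_subalgebra_def
      by (rule endo.subspace_Inter) (auto simp: subalgebra_iff bracket_closed_def)
    show "lie_bracket X Y \<in> generated_subalgebra scale pr F"
      if "X \<in> generated_subalgebra scale pr F" "Y \<in> generated_subalgebra scale pr F" for X Y
      using that unfolding generated_subalgebra_def subalgebra_iff bracket_closed_def by blast
  qed (use gl_endomorphism in blast)
  ultimately show ?thesis
    by (simp add: subalgebra_iff)
qed

lemma tr_eq_0_of_solvable:
  assumes "X \<in> gl scale pr" "Y \<in> gl scale pr" "nilpotent_endo Y"
    and "solvable scale (generated_subalgebra scale pr {X, Y})"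
  shows "tr scale pr (X \<circ> Y) = 0"
proof -
  let ?G = "generated_subalgebra scale pr {X, Y}"
  obtain ps qs where ps: "X = tensor_op scale pr ps" and qs: "Y = tensor_op scale pr qs"
    using assms(1,2) by (auto simp: gl_def)
  define A where "A = fst ` set ps \<union> fst ` set qs"
  \<comment> \<open>Operators with range in \<open>span A\<close> preserve \<open>span A\<close>.
    Since they form a subalgebra containing \<open>X\<close> and \<open>Y\<close>, this passes to
    all of \<open>?G\<close> and supplies the invariant finite-dimensional space for the triangular
    basis.\<close>
  let ?H = "{T \<in> gl scale pr. range T \<subseteq> span A}"
  have "subalgebra scale pr ?H"
    unfolding subalgebra_iff bracket_closed_def
  proof (intro conjI ballI)
    show "endo.subspace ?H"
      using subspace_gl
      by (intro endo.subspaceI)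
        (auto simp: endo.subspace_0 span_zero image_subset_iff
          intro!: endo.subspace_add endo.subspace_scale span_add span_scale)
    show "lie_bracket S T \<in> ?H" if "S \<in> ?H" "T \<in> ?H" for S T
      using that bracket_closed_gl
      by (auto simp: bracket_closed_def lie_bracket_def image_subset_iff intro!: span_diff)
  qed (use gl_endomorphism in auto)
  moreover have "{X, Y} \<subseteq> ?H"
    using assms(1,2) tensor_op_in_span[of ps] tensor_op_in_span[of qs]
      span_mono[of "fst ` set ps" A] span_mono[of "fst ` set qs" A]
    unfolding A_def ps qs by blast
  ultimately have G: "?G \<subseteq> ?H"
    by (rule generated_minimal)
  have XY: "X \<in> ?G" "Y \<in> ?G"
    using generated_subset by blast+
  have "bracket_closed ?G"
    using subalgebra_generated[of "{X, Y}"] assms(1,2) by (simp add: subalgebra_iff)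
  moreover obtain n where "derived_series scale ?G n = {\<lambda>_. 0}"
    using assms(4) by (auto simp: solvable_def)
  moreover have "invariant T (span A)" if "T \<in> ?G" for T
    using that G by blast
  moreover have "finite A"
    by (simp add: A_def)
  ultimately obtain B where B: "finite B" "independent B" "span B = span A"
    "\<And>e. e \<in> B \<Longrightarrow> X (Y e) \<in> span (B - {e})"
    using triangular_basis[OF _ _ subspace_span _ order_refl _ XY assms(3)] by metis
  \<comment> \<open>Applying \<open>X\<close> to the vectors of \<open>qs\<close> writes
    \<open>XY\<close> as a tensor with vectors in the range of \<open>X\<close>, hence in
    \<open>span B\<close>, so its trace can be read off in \<open>B\<close>.\<close>
  let ?rs = "map (\<lambda>(v, w). (X v, w)) qs"
  have XY_eq: "X \<circ> Y = tensor_op scale pr ?rs"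
    unfolding qs using comp_tensor_op gl_endomorphism[OF assms(1)] by blast
  have "X v \<in> span B" for v
    using XY(1) G B(3) by auto
  then have "fst ` set ?rs \<subseteq> span B"
    by auto
  then have "tr scale pr (X \<circ> Y) = (\<Sum>e\<in>B. representation B ((X \<circ> Y) e) e)"
    unfolding XY_eq tr_tensor_op using sum_pr_eq[OF B(1,2)] by blast
  also have "\<dots> = 0"
  proof (rule sum.neutral, rule ballI)
    fix e assume e: "e \<in> B"
    have "representation B (X (Y e)) = representation (B - {e}) (X (Y e))"
      using representation_extend[OF B(2) B(4)[OF e]] by blast
    then show "representation B ((X \<circ> Y) e) e = 0"
      using representation_ne_zero[of "B - {e}" "X (Y e)" e] by auto
  qed
  finally show ?thesis .
qed

subsection \<open>Local finiteness and the locally solvable radical\<close>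

text \<open>Take the rank-one operators built from the finitely many vectors and covectors occurring
  in \<open>F\<close>. A product of two of them is a scalar multiple of a third, so their span is
  closed under composition and contains the generated subalgebra.\<close>

lemma generated_finite_dimensional:
  assumes "finite F" "F \<subseteq> gl scale pr"
  obtains E where "finite E" "generated_subalgebra scale pr F \<subseteq> endo.span E"
proof -
  have "\<forall>X\<in>F. \<exists>ps. X = tensor_op scale pr ps"
    using assms(2) by (auto simp: gl_def)
  then obtain rep where rep: "\<And>X. X \<in> F \<Longrightarrow> X = tensor_op scale pr (rep X)"
    by metis
  define A where "A = (\<Union>X\<in>F. fst ` set (rep X))"
  define C where "C = (\<Union>X\<in>F. snd ` set (rep X))"
  define E where "E = {tensor_op scale pr [(v, w)] | v w. v \<in> A \<and> w \<in> C}"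
  have single: "tensor_op scale pr [(v, w)] = (\<lambda>u. pr u w *s v)" for v w
    by (simp add: tensor_op_def)
  have E_gl: "E \<subseteq> gl scale pr"
    by (auto simp: E_def gl_def)
  have span_gl: "endo.span E \<subseteq> gl scale pr"
    by (rule endo.span_minimal[OF E_gl subspace_gl])
  have comp_E: "X \<circ> Y \<in> endo.span E" if XY: "X \<in> E" "Y \<in> E" for X Y
  proof -
    obtain v w where "v \<in> A" and X: "X = tensor_op scale pr [(v, w)]"
      using XY(1) unfolding E_def by blast
    obtain v' w' where "w' \<in> C" and Y: "Y = tensor_op scale pr [(v', w')]"
      using XY(2) unfolding E_def by blast
    have "X \<circ> Y = endo_scale (pr v' w) (tensor_op scale pr [(v, w')])"
      by (simp add: X Y single fun_eq_iff pr_scale mult.commute)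
    moreover have "tensor_op scale pr [(v, w')] \<in> E"
      using \<open>v \<in> A\<close> \<open>w' \<in> C\<close> unfolding E_def by blast
    ultimately show ?thesis
      using endo.span_scale endo.span_base by metis
  qed
  have comp_left: "X \<circ> Y \<in> endo.span E" if "X \<in> endo.span E" "Y \<in> E" for X Y
    using that(1)
  proof (induction rule: endo.span_induct_alt)
    case base
    have *: "(0 :: 'v \<Rightarrow> 'v) \<circ> Y = 0"
      by (simp add: fun_eq_iff)
    show ?case
      unfolding * by (rule endo.span_zero)
  next
    case (step c Z X)
    have "(endo_scale c Z + X) \<circ> Y = endo_scale c (Z \<circ> Y) + (X \<circ> Y)"
      by (simp add: fun_eq_iff)
    then show ?case
      using step comp_E that(2) by (metis endo.span_add endo.span_scale)
  qed
  have comp: "X \<circ> Y \<in> endo.span E" if "X \<in> endo.span E" "Y \<in> endo.span E" for X Y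
    using that(2)
  proof (induction rule: endo.span_induct_alt)
    case base
    have *: "X \<circ> 0 = 0"
      using gl_endomorphism that(1) span_gl by (auto simp: fun_eq_iff endomorphism_0)
    show ?case
      unfolding * by (rule endo.span_zero)
  next
    case (step c Z Y)
    have "X \<circ> (endo_scale c Z + Y) = endo_scale c (X \<circ> Z) + (X \<circ> Y)"
      using gl_endomorphism that(1) span_gl
      by (auto simp: fun_eq_iff endomorphism_add endomorphism_scale)
    then show ?case
      using step comp_left that(1) by (metis endo.span_add endo.span_scale)
  qed
  have "subalgebra scale pr (endo.span E)"
    unfolding subalgebra_iff bracket_closed_def lie_bracket_eq
    using span_gl gl_endomorphism comp by (blast intro: endo.span_diff endo.subspace_span)
  moreover have "F \<subseteq> endo.span E"
  proof
    fix X assume X: "X \<in> F"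
    have "tensor_op scale pr ps \<in> endo.span E" if "set ps \<subseteq> set (rep X)" for ps
      using that
    proof (induction ps)
      case Nil
      show ?case
        unfolding tensor_op_Nil by (rule endo.span_zero)
    next
      case (Cons p ps)
      then have "fst p \<in> A" "snd p \<in> C"
        using X by (auto simp: A_def C_def)
      then have "tensor_op scale pr [p] \<in> E"
        unfolding E_def by (cases p) auto
      moreover have "tensor_op scale pr (p # ps) = tensor_op scale pr [p] + tensor_op scale pr ps"
        using tensor_op_append[of "[p]" ps] by simp
      moreover have "tensor_op scale pr ps \<in> endo.span E"
        using Cons by simp
      ultimately show ?case
        by (metis endo.span_add endo.span_base)
    qed
    then show "X \<in> endo.span E"
      using rep[OF X] by (metis order_refl)
  qed
  ultimately have "generated_subalgebra scale pr F \<subseteq> endo.span E"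
    by (rule generated_minimal)
  moreover have "finite E"
    using assms(1) unfolding E_def A_def C_def by (intro finite_image_set2) simp_all
  ultimately show thesis
    using that by blast
qed

lemma derived_series_mono:
  "S \<subseteq> T \<Longrightarrow> derived_series scale S n \<subseteq> derived_series scale T n"
proof (induction n)
  case (Suc n)
  then show ?case
    unfolding derived_series_Suc_endo by (intro endo.span_mono) blast
qed simp

text \<open>This compares derived series modulo \<open>J\<close> without forming the quotient:
  \<open>[a + j, b + k]\<close> differs from \<open>[a, b]\<close> by an element of
  \<open>J\<close>.\<close>

lemma derived_series_subset_sum:
  assumes "endo.subspace A" "endo.subspace J"
    and "\<And>X Y. X \<in> A \<Longrightarrow> Y \<in> A \<Longrightarrow> lie_bracket X Y \<in> A"
    and "\<And>X Y. X \<in> A \<Longrightarrow> Y \<in> J \<Longrightarrow> lie_bracket X Y \<in> J"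
    and "\<And>X Y. X \<in> J \<Longrightarrow> Y \<in> J \<Longrightarrow> lie_bracket X Y \<in> J"
    and "\<And>X. X \<in> A \<union> J \<Longrightarrow> endomorphism X"
    and "G \<subseteq> {X + Y | X Y. X \<in> A \<and> Y \<in> J}"
  shows "derived_series scale G n \<subseteq> {X + Y | X Y. X \<in> derived_series scale A n \<and> Y \<in> J}"
proof (induction n)
  case 0
  then show ?case using assms(7) by (simp only: derived_series.simps)
next
  case (Suc n)
  let ?R = "{X + Y | X Y. X \<in> derived_series scale A (Suc n) \<and> Y \<in> J}"
  have "lie_bracket X Y \<in> ?R"
    if XY: "X \<in> derived_series scale G n" "Y \<in> derived_series scale G n" for X Y
  proof -
    obtain a j b k where X: "X = a + j" "a \<in> derived_series scale A n" "j \<in> J"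
      and Y: "Y = b + k" "b \<in> derived_series scale A n" "k \<in> J"
      using Suc XY by blast
    have ab: "a \<in> A" "b \<in> A"
      using X Y derived_series_subset[OF assms(1)] assms(3) by blast+
    have "lie_bracket X Y = lie_bracket a b + (lie_bracket a k - lie_bracket b j + lie_bracket j k)"
      using assms(6) ab X(3) Y(3)
      by (auto simp: X(1) Y(1) lie_bracket_def fun_eq_iff endomorphism_add)
    moreover have "lie_bracket a b \<in> derived_series scale A (Suc n)"
      by (rule lie_bracket_derived) (fact X(2) Y(2))+
    moreover have "lie_bracket a k - lie_bracket b j + lie_bracket j k \<in> J"
      using assms(2,4,5) ab X(3) Y(3) by (blast intro: endo.subspace_add endo.subspace_diff)
    ultimately show ?thesis by blast
  qed
  moreover have "endo.subspace ?R"
    by (intro endo.subspace_sums subspace_derived_series assms(1,2))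
  ultimately show ?case
    unfolding derived_series_Suc_endo[of G] by (intro endo.span_minimal) blast+
qed

lemma lie_ideal_iff: "lie_ideal scale I P \<longleftrightarrow>
    endo.subspace I \<and> I \<subseteq> P \<and> (\<forall>X\<in>P. \<forall>Y\<in>I. lie_bracket X Y \<in> I)"
  by (simp add: lie_ideal_def endo_subspace_iff)

lemma endo_span_subset: "subalgebra scale pr S \<Longrightarrow> F \<subseteq> S \<Longrightarrow> endo.span F \<subseteq> S"
  by (auto simp: subalgebra_iff bracket_closed_def dest: endo.span_minimal)

lemma lie_ideal_sum:
  assumes "subalgebra scale pr P" "lie_ideal scale I P" "lie_ideal scale J P"
  shows "lie_ideal scale {X + Y | X Y. X \<in> I \<and> Y \<in> J} P"
proof -
  have P: "endo.subspace P" "\<And>X. X \<in> P \<Longrightarrow> endomorphism X"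
    using assms(1) by (auto simp: subalgebra_iff bracket_closed_def)
  have "lie_bracket Z (X + Y) = lie_bracket Z X + lie_bracket Z Y" if "Z \<in> P" for X Y Z
    using P(2)[OF that] by (simp add: lie_bracket_def fun_eq_iff endomorphism_add)
  then show ?thesis
    using assms(2,3) P(1) unfolding lie_ideal_iff
    by (auto intro!: endo.subspace_sums endo.subspace_add) blast
qed

text \<open>For a finite set \<open>F \<subseteq> I + J\<close> some derived algebra of the subalgebra generated by \<open>F\<close>
  lies in \<open>J\<close>; being finite-dimensional, it sits in a finitely generated, hence solvable,
  subalgebra of \<open>J\<close>.\<close>
lemma locally_solvable_sum:
  assumes P: "subalgebra scale pr P"
    and I: "lie_ideal scale I P" "locally_solvable scale pr I"
    and J: "lie_ideal scale J P" "locally_solvable scale pr J"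
  shows "locally_solvable scale pr {X + Y | X Y. X \<in> I \<and> Y \<in> J}"
  unfolding locally_solvable_def
proof (intro allI impI)
  fix F assume F: "finite F \<and> F \<subseteq> {X + Y | X Y. X \<in> I \<and> Y \<in> J}"
  have P': "P \<subseteq> gl scale pr" "\<And>X. X \<in> P \<Longrightarrow> endomorphism X" "endo.subspace P"
    using P by (auto simp: subalgebra_iff bracket_closed_def)
  have J': "endo.subspace J" "J \<subseteq> P" "\<And>X Y. X \<in> P \<Longrightarrow> Y \<in> J \<Longrightarrow> lie_bracket X Y \<in> J"
    using J(1) by (auto simp: lie_ideal_iff)
  have "\<forall>Z\<in>F. \<exists>X Y. X \<in> I \<and> Y \<in> J \<and> Z = X + Y"
    using F by blast
  then obtain f g where fg: "\<And>Z. Z \<in> F \<Longrightarrow> f Z \<in> I \<and> g Z \<in> J \<and> Z = f Z + g Z"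
    by metis
  let ?A = "generated_subalgebra scale pr (f ` F)" and ?G = "generated_subalgebra scale pr F"
  have fF: "f ` F \<subseteq> I" "f ` F \<subseteq> P"
    using fg I(1) by (auto simp: lie_ideal_iff)
  have A: "?A \<subseteq> P" "subalgebra scale pr ?A"
    using generated_minimal[OF P fF(2)] subalgebra_generated fF(2) P'(1) by blast+
  then have A': "endo.subspace ?A" "\<And>X Y. X \<in> ?A \<Longrightarrow> Y \<in> ?A \<Longrightarrow> lie_bracket X Y \<in> ?A"
    by (auto simp: subalgebra_iff bracket_closed_def)
  obtain n where n: "derived_series scale ?A n = {\<lambda>_. 0}"
    using I(2) F fF(1) unfolding locally_solvable_def solvable_def by (meson finite_imageI)
  let ?H = "{X + Y | X Y. X \<in> ?A \<and> Y \<in> J}"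
  have sum: "derived_series scale G k
      \<subseteq> {X + Y | X Y. X \<in> derived_series scale ?A k \<and> Y \<in> J}" if "G \<subseteq> ?H" for G k
    by (rule derived_series_subset_sum[OF A'(1) J'(1) A'(2) _ _ _ that])
      (use A(1) J'(2,3) P'(2) in blast)+
  have "?H \<subseteq> P"
    using A(1) J'(2) endo.subspace_add[OF P'(3)] by blast
  \<comment> \<open>A bracket of elements of \<open>?H\<close> lies in the first derived algebra of
    \<open>?H\<close>, so closure is read off from \<open>sum\<close> with
    \<open>k = 1\<close>.\<close>
  moreover have "lie_bracket X Y \<in> ?H" if "X \<in> ?H" "Y \<in> ?H" for X Y
    using lie_bracket_derived[of X ?H 0 Y] that sum[OF order_refl, of "Suc 0"]
      derived_series_subset[OF A'(1), of "Suc 0"] A'(2)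
    unfolding derived_series.simps(1) by blast
  ultimately have "subalgebra scale pr ?H"
    unfolding subalgebra_iff bracket_closed_def
    using P'(1,2) endo.subspace_sums[OF A'(1) J'(1)] by blast
  moreover have "F \<subseteq> ?H"
    using fg generated_subset[of "f ` F"] by blast
  ultimately have "?G \<subseteq> ?H"
    by (rule generated_minimal)
  then have D: "derived_series scale ?G n \<subseteq> J"
    using sum[of ?G n] by (auto simp: n zero_fun_def[symmetric])
  have F_gl: "F \<subseteq> gl scale pr"
    using \<open>F \<subseteq> ?H\<close> \<open>?H \<subseteq> P\<close> P'(1) by blast
  then have G: "endo.subspace ?G" "\<And>X Y. X \<in> ?G \<Longrightarrow> Y \<in> ?G \<Longrightarrow> lie_bracket X Y \<in> ?G"
    using subalgebra_generated by (auto simp: subalgebra_iff bracket_closed_def)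
  obtain E where E: "finite E" "?G \<subseteq> endo.span E"
    using generated_finite_dimensional F F_gl by blast
  obtain F' where F': "F' \<subseteq> derived_series scale ?G n" "endo.independent F'"
    "derived_series scale ?G n \<subseteq> endo.span F'"
    using endo.basis_exists by metis
  have "F' \<subseteq> endo.span E"
    using F'(1) derived_series_subset[OF G(1)] G(2) E(2) by blast
  then have "finite F'"
    using endo.independent_span_bound[OF E(1) F'(2)] by blast
  then obtain m where m: "derived_series scale (generated_subalgebra scale pr F') m = {\<lambda>_. 0}"
    using J(2) F'(1) D unfolding locally_solvable_def solvable_def by (meson order_trans)
  have "subalgebra scale pr (generated_subalgebra scale pr F')"
    using F'(1) D J'(2) P'(1) by (intro subalgebra_generated) blast
  then have "derived_series scale ?G n \<subseteq> generated_subalgebra scale pr F'"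
    using F'(3) endo_span_subset generated_subset by blast
  then have "derived_series scale ?G (n + m) \<subseteq> {\<lambda>_. 0}"
    using derived_series_mono[of _ _ m] m by (metis derived_series_add)
  moreover have "(\<lambda>_. 0) \<in> derived_series scale ?G (n + m)"
    using endo.subspace_0[OF subspace_derived_series[OF G(1)]] by (simp add: zero_fun_def)
  ultimately show "solvable scale ?G"
    unfolding solvable_def by blast
qed

lemma zero_ideal:
  assumes "subalgebra scale pr P"
  shows "lie_ideal scale {0} P" "locally_solvable scale pr {0}"
proof -
  have P: "endo.subspace P" "\<And>X. X \<in> P \<Longrightarrow> endomorphism X"
    using assms by (auto simp: subalgebra_iff bracket_closed_def)
  have bracket: "lie_bracket X 0 = 0" if "endomorphism X" for X
    using that by (simp add: lie_bracket_def fun_eq_iff endomorphism_0)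
  show "lie_ideal scale {0} P"
    using P bracket by (auto simp: lie_ideal_iff endo.subspace_0)
  have "endomorphism 0"
    by (simp add: endomorphism_iff)
  then have zero: "subalgebra scale pr {0}"
    using bracket endo.subspace_0[OF subspace_gl] by (simp add: subalgebra_iff bracket_closed_def)
  show "locally_solvable scale pr {0}"
    unfolding locally_solvable_def
  proof (intro allI impI)
    fix F :: "('v \<Rightarrow> 'v) set" assume F: "finite F \<and> F \<subseteq> {0}"
    then have "generated_subalgebra scale pr F \<subseteq> {0}"
      using generated_minimal[OF zero] by blast
    moreover have "F \<subseteq> gl scale pr"
      using F zero by (auto simp: subalgebra_iff)
    then have "0 \<in> generated_subalgebra scale pr F"
      using subalgebra_generated endo.subspace_0 by (auto simp: subalgebra_iff bracket_closed_def)
    ultimately have "derived_series scale (generated_subalgebra scale pr F) 0 = {\<lambda>_. 0}"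
      by (auto simp: zero_fun_def)
    then show "solvable scale (generated_subalgebra scale pr F)"
      unfolding solvable_def by blast
  qed
qed

text \<open>The greatest element is the union of all locally solvable ideals of \<open>P\<close>.
  Sums make the family directed, so each finite subset of the union lies in one member, and both
  closure and local solvability are inherited from that member.\<close>

lemma ls_radical:
  assumes P: "subalgebra scale pr P"
  shows "lie_ideal scale (ls_radical scale pr P) P"
    and "locally_solvable scale pr (ls_radical scale pr P)"
proof -
  define \<I> where "\<I> = {I. lie_ideal scale I P \<and> locally_solvable scale pr I}"
  have directed: "\<exists>I\<in>\<I>. F \<subseteq> I" if "finite F" "F \<subseteq> \<Union>\<I>" for F
    using that
  proof (induction F rule: finite_induct)
    case empty
    then show ?case
      using zero_ideal[OF P] by (auto simp: \<I>_def)
  next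
    case (insert X F)
    then obtain I J where IJ: "I \<in> \<I>" "J \<in> \<I>" "X \<in> I" "F \<subseteq> J"
      by auto
    let ?S = "{X + Y | X Y. X \<in> I \<and> Y \<in> J}"
    have "0 \<in> I" "0 \<in> J"
      using IJ(1,2) by (auto simp: \<I>_def lie_ideal_iff endo.subspace_0)
    then have "X + 0 \<in> ?S" "0 + Y \<in> ?S" if "X \<in> I" "Y \<in> J" for X Y
      using that by blast+
    then have "I \<subseteq> ?S" "J \<subseteq> ?S"
      using \<open>0 \<in> I\<close> \<open>0 \<in> J\<close> by auto
    moreover have "?S \<in> \<I>"
      using IJ(1,2) lie_ideal_sum[OF P, of I J] locally_solvable_sum[OF P, of I J]
      unfolding \<I>_def by blast
    ultimately show ?case
      using IJ(3,4) by (meson insert_subset subset_iff)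
  qed
  have "lie_ideal scale (\<Union>\<I>) P"
    unfolding lie_ideal_iff
  proof (intro conjI ballI)
    show "endo.subspace (\<Union>\<I>)"
    proof (rule endo.subspaceI)
      obtain I where "I \<in> \<I>"
        using directed[of "{}"] by auto
      then show "0 \<in> \<Union>\<I>"
        by (auto simp: \<I>_def lie_ideal_iff intro: endo.subspace_0)
    next
      fix X Y assume "X \<in> \<Union>\<I>" "Y \<in> \<Union>\<I>"
      then obtain I where "I \<in> \<I>" "X \<in> I" "Y \<in> I"
        using directed[of "{X, Y}"] by auto
      then show "X + Y \<in> \<Union>\<I>"
        by (auto simp: \<I>_def lie_ideal_iff intro: endo.subspace_add)
    next
      fix c X assume "X \<in> \<Union>\<I>"
      then show "endo_scale c X \<in> \<Union>\<I>"
        by (auto simp: \<I>_def lie_ideal_iff intro: endo.subspace_scale)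
    qed
  qed (auto simp: \<I>_def lie_ideal_iff)
  moreover have "locally_solvable scale pr (\<Union>\<I>)"
    unfolding locally_solvable_def
  proof (intro allI impI)
    fix F assume "finite F \<and> F \<subseteq> \<Union>\<I>"
    moreover from this obtain I where "I \<in> \<I>" "F \<subseteq> I"
      using directed by blast
    ultimately show "solvable scale (generated_subalgebra scale pr F)"
      by (auto simp: \<I>_def locally_solvable_def)
  qed
  moreover have "ls_radical scale pr P = \<Union>\<I>"
    unfolding ls_radical_def
    by (rule Greatest_equality) (use calculation in \<open>auto simp: \<I>_def\<close>)
  ultimately show "lie_ideal scale (ls_radical scale pr P) P"
    and "locally_solvable scale pr (ls_radical scale pr P)"
    by simp_all
qed

section \<open>Maximal locally solvable subalgebras and the Borel subalgebra inside
  \<open>P\<close>\<close>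

lemma maximal_locally_solvable:
  assumes P: "subalgebra scale pr P"
    and R: "subalgebra scale pr R" "locally_solvable scale pr R" "R \<subseteq> P"
  obtains B where "subalgebra scale pr B" "locally_solvable scale pr B" "R \<subseteq> B" "B \<subseteq> P"
    and "\<And>B'. subalgebra scale pr B' \<Longrightarrow> locally_solvable scale pr B' \<Longrightarrow> B \<subseteq> B' \<Longrightarrow> B' \<subseteq> P
      \<Longrightarrow> B' = B"
proof -
  define \<B> where "\<B> = {B. subalgebra scale pr B \<and> locally_solvable scale pr B \<and> R \<subseteq> B \<and> B \<subseteq> P}"
  have "\<exists>B\<in>\<B>. \<forall>B'\<in>\<B>. B \<subseteq> B' \<longrightarrow> B' = B"
  proof (rule subset_Zorn_nonempty)
    show "\<B> \<noteq> {}"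
      using R by (auto simp: \<B>_def)
    fix \<C> assume \<C>: "\<C> \<noteq> {}" "subset.chain \<B> \<C>"
    then have sub: "\<C> \<subseteq> \<B>"
      by (auto simp: subset_chain_def)
    \<comment> \<open>Local solvability is tested on finite subsets, and each of these already lies
      in one member of the chain; this is why Zorn's lemma applies.\<close>
    have directed: "\<exists>B\<in>\<C>. F \<subseteq> B" if "finite F" "F \<subseteq> \<Union>\<C>" for F
      using finite_subset_Union_chain[OF that \<C>] by blast
    have bc: "bracket_closed B" if "B \<in> \<C>" for B
      using that sub by (auto simp: \<B>_def subalgebra_iff)
    have "\<Union>\<C> \<subseteq> P"
      using sub by (auto simp: \<B>_def)
    moreover have "bracket_closed (\<Union>\<C>)"
      unfolding bracket_closed_def
    proof (intro conjI ballI)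
      have pair: "\<exists>B\<in>\<C>. X \<in> B \<and> Y \<in> B" if "X \<in> \<Union>\<C>" "Y \<in> \<Union>\<C>" for X Y
        using directed[of "{X, Y}"] that by auto
      show "endo.subspace (\<Union>\<C>)"
      proof (rule endo.subspaceI)
        show "0 \<in> \<Union>\<C>"
          using \<C>(1) bc endo.subspace_0 unfolding bracket_closed_def by blast
        show "X + Y \<in> \<Union>\<C>" if "X \<in> \<Union>\<C>" "Y \<in> \<Union>\<C>" for X Y
          using pair[OF that] bc by (auto simp: bracket_closed_def intro: endo.subspace_add)
        show "endo_scale c X \<in> \<Union>\<C>" if "X \<in> \<Union>\<C>" for c X
          using that bc by (auto simp: bracket_closed_def intro: endo.subspace_scale)
      qed
      show "endomorphism X" if "X \<in> \<Union>\<C>" for X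
        using that bc by (auto simp: bracket_closed_def)
      show "lie_bracket X Y \<in> \<Union>\<C>" if "X \<in> \<Union>\<C>" "Y \<in> \<Union>\<C>" for X Y
        using pair[OF that] bc unfolding bracket_closed_def by blast
    qed
    moreover have "locally_solvable scale pr (\<Union>\<C>)"
      unfolding locally_solvable_def
    proof (intro allI impI)
      fix F assume F: "finite F \<and> F \<subseteq> \<Union>\<C>"
      then obtain B where "B \<in> \<C>" "F \<subseteq> B"
        using directed by blast
      then show "solvable scale (generated_subalgebra scale pr F)"
        using F sub by (auto simp: \<B>_def locally_solvable_def)
    qed
    moreover have "R \<subseteq> \<Union>\<C>"
      using \<C>(1) sub by (auto simp: \<B>_def)
    ultimately show "\<Union>\<C> \<in> \<B>"
      using P by (auto simp: \<B>_def subalgebra_iff)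
  qed
  then obtain B where B: "B \<in> \<B>" "\<And>B'. B' \<in> \<B> \<Longrightarrow> B \<subseteq> B' \<Longrightarrow> B' = B"
    by blast
  show thesis
  proof (rule that)
    show "subalgebra scale pr B" "locally_solvable scale pr B" "R \<subseteq> B" "B \<subseteq> P"
      using B(1) by (simp_all add: \<B>_def)
    show "B' = B"
      if "subalgebra scale pr B'" "locally_solvable scale pr B'" "B \<subseteq> B'" "B' \<subseteq> P" for B'
      by (rule B(2)) (use that B(1) in \<open>auto simp: \<B>_def\<close>)
  qed
qed

lemma parabolic_of_orth_compl:
  assumes P: "subalgebra scale pr P"
    and orth: "P = orth_compl scale pr (linear_nilradical scale pr P)"
  shows "parabolic_subalgebra scale pr P"
proof -
  let ?R = "ls_radical scale pr P"
  note R = ls_radical[OF P]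
  have "subalgebra scale pr ?R"
    using R(1) P unfolding subalgebra_iff bracket_closed_def lie_ideal_iff by blast
  then obtain B where B: "subalgebra scale pr B" "locally_solvable scale pr B" "?R \<subseteq> B" "B \<subseteq> P"
    and max: "\<And>B'. subalgebra scale pr B' \<Longrightarrow> locally_solvable scale pr B' \<Longrightarrow> B \<subseteq> B' \<Longrightarrow> B' \<subseteq> P
      \<Longrightarrow> B' = B"
    using maximal_locally_solvable[OF P _ R(2)] R(1) unfolding lie_ideal_iff by metis
  have "B' = B" if B': "subalgebra scale pr B'" "locally_solvable scale pr B'" "B \<subseteq> B'" for B'
  \<comment> \<open>What remains is \<open>B' \<subseteq> P\<close>, the only condition of relative
    maximality that \<open>B'\<close> does not satisfy by assumption.\<close>
  proof (rule max[OF B'])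
    have "X \<in> orth_compl scale pr (linear_nilradical scale pr P)" if X: "X \<in> B'" for X
      unfolding orth_compl_def
    proof (intro CollectI conjI ballI)
      show "X \<in> gl scale pr"
        using X B'(1) by (auto simp: subalgebra_iff)
      fix Y assume "Y \<in> linear_nilradical scale pr P"
      then have Y: "Y \<in> B'" "nilpotent_endo Y"
        using B(3) B'(3) by (auto simp: linear_nilradical_def)
      have "solvable scale (generated_subalgebra scale pr {X, Y})"
        using B'(2) X Y(1) by (auto simp: locally_solvable_def)
      then show "tr scale pr (X \<circ> Y) = 0"
        using tr_eq_0_of_solvable X Y B'(1) by (auto simp: subalgebra_iff)
    qed
    then show "B' \<subseteq> P"
      using orth by blast
  qed
  then have "borel_subalgebra scale pr B"
    using B(1,2) by (auto simp: borel_subalgebra_def)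
  then show ?thesis
    using P B(4) by (auto simp: parabolic_subalgebra_def)
qed

end

theorem theorem5p9:
  fixes sV :: "complex \<Rightarrow> 'v \<Rightarrow> 'v::ab_group_add"
    and sW :: "complex \<Rightarrow> 'w \<Rightarrow> 'w::ab_group_add"
    and pr :: "'v \<Rightarrow> 'w \<Rightarrow> complex"
    and P :: "('v \<Rightarrow> 'v) set"
  assumes "vector_space sV" and "vector_space sW"
    and "countable_dim sV" and "countable_dim sW"
    and "bilinear_pairing sV sW pr" and "nondegenerate_pairing pr"
    and "subalgebra sV pr P"
    and "P = orth_compl sV pr (linear_nilradical sV pr P)"
  shows "parabolic_subalgebra sV pr P"
proof -
  interpret V: vector_space sV
    by fact
  \<comment> \<open>Additivity is the case \<open>a = 1\<close>; homogeneity is the case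
    \<open>v' = 0\<close>, once \<open>pr 0 w = 0\<close> is known.\<close>
  have bilinear: "pr (sV a v + v') w = a * pr v w + pr v' w" for a v v' w
    using assms(5) by (simp add: bilinear_pairing_def)
  have zero: "pr 0 w = 0" for w
    using bilinear[of 1 0 0 w] by simp
  interpret pairing_space sV pr
    by unfold_locales (use bilinear[of 1] bilinear[of _ _ 0] zero in simp_all)
  show ?thesis
    using assms(7,8) by (rule parabolic_of_orth_compl)
qed

end
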